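(* Let $f$ be admissible and let $\mathfrak L$ be the liquid region (see context). Let $\mathcal K\subset\mathfrak L$ be a compact set. Then there exist constants $N_{\mathcal K}>0$ and $\varepsilon_{\mathcal K}\in(0,\pi)$ such that if $n>N_{\mathcal K}$ and $\frac{1}{n+1}e_{\iota_1,\iota_1'}(j,k)$, $\frac1{n+1}e_{\iota_2,\iota_2'}(j,k)$ are contained in $\mathcal K$, then the angle between the two edges $d\widetilde{\mathcal T}_n(e_{\iota_1,\iota_1'}(j,k))$ and $d\widetilde{\mathcal T}_n(e_{\iota_2,\iota_2'}(j,k))$, when these are adjacent to a common face (i.e. the angle of that face of the t-embedding at the vertex $\widetilde{\mathcal T}_n(j,k)$), is contained in $(\varepsilon_{\mathcal K},\pi-\varepsilon_{\mathcal K})$.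
   Context: **Admissible functions.** $f:\mathbb{R}\to\mathbb{R}$ is admissible if $f(-1)=1$, there is a smallest $x_*>-1$ with $f(x_* )=x_*$, and $|f'(x)|\le1$ for all $x\in[-1,x_*]$. Set $\bar f(x)=-x$ for $x<-1$, $\bar f(x)=f(x)$ for $x\in[-1,x_*]$, $\bar f(x)=x$ for $x>x_*$. **Up-down paths.** An up-down path is $H:\mathbb{Z}\to\mathbb{Z}$ with $H(c+1)-H(c)=\pm1$, interpolated linearly to $\mathbb{R}$; here we use those with $H(c)+c$ odd for all $c$. $H^f_n$ is the (pointwise) largest such path with $\frac{1}{n+1}\left(H_n^f((n+1)x)+1\right)\le\bar f(x)$ for all $x\in\mathbb{R}$. It records the number of faces in each column $c=j+k$ of the generalized tower graph of rank $n$ approximating $f$, whose faces are labelled by $(j,k)\in\mathbb{Z}^2$. **Aztec t-embedding.** Let $\mathcal T_n(j,k)=F(j,k,n)$ ($j+k+n$ odd), where $F$ is the unique solution of: $F(j,k,n)=0$ if $|j|+|k|\ge n$; $F(0,0,1)=0$; for $n\ge1$, $F(n,0,n+1)=\frac12(F(n-1,0,n)+1)$, $F(0,n,n+1)=\frac12(F(0,n-1,n)+i)$, $F(-n,0,n+1)=\frac12(F(-n+1,0,n)-1)$, $F(0,-n,n+1)=\frac12(F(0,-n+1,n)-i)$; and for all other $|j|+|k|\le n$, $F(j,k,n+1)+F(j,k,n-1)=\frac12\left(F(j+1,k,n)+F(j-1,k,n)+F(j,k+1,n)+F(j,k-1,n)\right)$. **The t-embedding $\widetilde{\mathcal T}_n$.**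 The perfect t-embedding of the reduced generalized tower graph of rank $n+1$ approximating $f$ takes at the face $(j,k)$ the value $\widetilde{\mathcal T}_n(j,k)=\mathcal T_r(j,k)$ with $r=r(n;j,k):=H^f_{n+1}(j+k)$. (A t-embedding is a proper embedding of the augmented dual graph such that around each inner vertex the angles of the black faces sum to $\pi$, likewise for the white faces, and whose edge lengths are gauge equivalent to the edge weights.) **Edges.** The faces $(j,k)$ and $(j+\iota,k+\iota')$ are joined by a dual edge $e_{\iota,\iota'}(j,k)$ when $(\iota,\iota')\in\{(\pm1,0),(0,\pm1)\}$, and also when $(\iota,\iota')\in\{(1,-1),(-1,1)\}$ if column $c=j+k$ consists of hexagons (i.e. $H^f_{n+1}(c-1),H^f_{n+1}(c),H^f_{n+1}(c+1)$ is monotone); otherwise column $c$ consists of squares. One has $d\widetilde{\mathcal T}_n(e_{\iota,\iota'}(j,k))=\pm\left(\widetilde{\mathcal T}_n(j+\iota,k+\iota')-\widetilde{\mathcal T}_n(j,k)\right)$, viewed as the edge of the embedding emanating from $\widetilde{\mathcal T}_n(j,k)$. Two edges at $(j,k)$ are adjacent to a common face of the embedding when they are consecutive in the cyclic order of the directions $(\iota,\iota')$ around $(j,k)$: $(1,0),(0,1),(-1,0),(0,-1)$ in a square column and $(1,0),(0,1),(-1,1),(-1,0),(0,-1),(1,-1)$ in a hexagonal column. $\frac{1}{n+1}e_{\iota,\iota'}(j,k)$ denotes the segment from $\frac{1}{n+1}(j,k)$ to $\frac1{n+1}(j+\iota,k+\iota')$. **Liquid region.** $\mathfrak L$ is the set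 of $(x,y)\in\mathbb{R}^2$ with $-1<x+y<x_*$, $|x-y|<f(x+y)$ and $2(x^2+y^2)<f(x+y)^2$. *)

theory Defs
  imports "HOL-Analysis.Analysis"
begin

text \<open>In the definition of admissible functions, \<open>x\<^sub>*\<close> is the smallest fixed point of \<open>f\<close> in \<open>(-1, \<infinity>)\<close>.\<close>

definition is_smallest_fixpoint :: "(real \<Rightarrow> real) \<Rightarrow> real \<Rightarrow> bool" where
  "is_smallest_fixpoint f xs \<longleftrightarrow>
     - 1 < xs \<and> f xs = xs \<and> (\<forall>y. - 1 < y \<and> f y = y \<longrightarrow> xs \<le> y)"

definition admissible :: "(real \<Rightarrow> real) \<Rightarrow> bool" where
  "admissible f \<longleftrightarrow>
     f (- 1) = 1 \<and>
     (\<exists>xs. is_smallest_fixpoint f xs \<and>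
        (\<forall>x\<in>{- 1..xs}. f differentiable (at x) \<and> \<bar>deriv f x\<bar> \<le> 1))"

definition xstar :: "(real \<Rightarrow> real) \<Rightarrow> real" where
  "xstar f = (THE xs. is_smallest_fixpoint f xs)"

lemma xstar_eq:
  assumes "is_smallest_fixpoint f xs"
  shows "xstar f = xs"
  unfolding xstar_def
  using assms by (intro the_equality) (auto simp: is_smallest_fixpoint_def intro: antisym)

definition fbar :: "(real \<Rightarrow> real) \<Rightarrow> real \<Rightarrow> real" where
  "fbar f x = (if x < - 1 then - x else if x \<le> xstar f then f x else x)"

definition liquid_region :: "(real \<Rightarrow> real) \<Rightarrow> (real \<times> real) set" where
  "liquid_region f =
     {(x, y). - 1 < x + y \<and> x + y < xstar f \<and> \<bar>x - y\<bar> < f (x + y) \<and>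
              2 * (x\<^sup>2 + y\<^sup>2) < (f (x + y))\<^sup>2}"

definition up_down_path :: "(int \<Rightarrow> int) \<Rightarrow> bool" where
  "up_down_path H \<longleftrightarrow>
     (\<forall>c. H (c + 1) - H c = 1 \<or> H (c + 1) - H c = - 1) \<and> (\<forall>c. odd (H c + c))"

definition lin_interp :: "(int \<Rightarrow> int) \<Rightarrow> real \<Rightarrow> real" where
  "lin_interp H x = (1 - frac x) * of_int (H \<lfloor>x\<rfloor>) + frac x * of_int (H (\<lfloor>x\<rfloor> + 1))"

definition path_below :: "(real \<Rightarrow> real) \<Rightarrow> nat \<Rightarrow> (int \<Rightarrow> int) \<Rightarrow> bool" where
  "path_below f n H \<longleftrightarrow>
     up_down_path H \<and>
     (\<forall>x. 1 / (real n + 1) * (lin_interp H ((real n + 1) * x) + 1) \<le> fbar f x)"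

text \<open>The order on functions is pointwise. For admissible \<open>f\<close> the greatest path exists
  (see \<open>max_path_props\<close> below).\<close>

definition max_path :: "(real \<Rightarrow> real) \<Rightarrow> nat \<Rightarrow> int \<Rightarrow> int" where
  "max_path f n = (GREATEST H. path_below f n H)"

lemma abs_le_fbar:
  assumes "admissible f"
  shows "\<bar>x\<bar> \<le> fbar f x"
proof -
  obtain xs where xs: "is_smallest_fixpoint f xs"
    and d: "\<And>y. y \<in> {- 1..xs} \<Longrightarrow> f differentiable (at y) \<and> \<bar>deriv f y\<bar> \<le> 1" and f1: "f (- 1) = 1"
    using assms by (auto simp: admissible_def)
  note eq = xstar_eq[OF xs]
  from xs have xs1: "- 1 < xs" "f xs = xs" and least: "\<And>y. - 1 < y \<Longrightarrow> f y = y \<Longrightarrow> xs \<le> y"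
    by (auto simp: is_smallest_fixpoint_def)
  have der: "(f has_real_derivative deriv f y) (at y)" if "y \<in> {- 1..xs}" for y
    using d[OF that] by (simp add: DERIV_deriv_iff_real_differentiable)
  have cont: "isCont f y" if "y \<in> {- 1..xs}" for y
    using der[OF that] DERIV_isCont by blast
  have low: "- y \<le> f y" if "- 1 \<le> y" "y \<le> xs" for y
  proof (cases "y = - 1")
    case False
    with that have "- 1 < y" by simp
    moreover have "(f has_real_derivative deriv f z) (at z)" if "- 1 \<le> z" "z \<le> y" for z
      using that \<open>y \<le> xs\<close> by (intro der) auto
    ultimately obtain z where z: "- 1 < z" "z < y" "f y - f (- 1) = (y - (- 1)) * deriv f z"
      using MVT2[of "- 1" y f "deriv f"] by blast
    have "deriv f z \<ge> - 1" using d[of z] z that by auto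
    then have "(y + 1) * deriv f z \<ge> (y + 1) * (- 1)"
      using that by (intro mult_left_mono) auto
    then show ?thesis using z f1 by simp
  qed (simp add: f1)
  have up: "y \<le> f y" if "- 1 \<le> y" "y \<le> xs" for y
  proof (rule ccontr)
    assume "\<not> y \<le> f y"
    then have neg: "f y - y < 0" by simp
    have "\<exists>z. - 1 \<le> z \<and> z \<le> y \<and> f z - z = 0"
      using neg that f1 by (intro IVT2) (auto intro!: continuous_intros cont)
    then obtain z where z: "- 1 \<le> z" "z \<le> y" "f z = z" by auto
    with f1 have "- 1 < z" by (cases "z = - 1") auto
    with least z that have "y = xs" by force
    with neg xs1 show False by simp
  qed
  have "xs \<ge> 0" using low[of xs] xs1 by simp
  then show ?thesis using low[of x] up[of x] by (auto simp: fbar_def eq)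
qed

lemma max_path_props:
  assumes f: "admissible f"
  shows "path_below f n (max_path f n)" "path_below f n G \<Longrightarrow> G \<le> max_path f n"
proof -
  define m where "m = real n + 1"
  have m: "m > 0" by (simp add: m_def)
  have at_int: "lin_interp G (of_int c) = of_int (G c)" for G c
    by (simp add: lin_interp_def)
  have up: "up_down_path G" if "path_below f n G" for G
    using that by (simp add: path_below_def)
  have bound: "real_of_int (G c) \<le> m * fbar f (of_int c / m) - 1" if "path_below f n G" for G c
  proof -
    have "1 / m * (lin_interp G (m * (of_int c / m)) + 1) \<le> fbar f (of_int c / m)"
      using that unfolding path_below_def m_def by blast
    then show ?thesis using m by (simp add: at_int field_simps)
  qed
  have base: "path_below f n (\<lambda>c. \<bar>c\<bar> - 1)"
    unfolding path_below_def m_def[symmetric]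
  proof (intro conjI allI)
    show "up_down_path (\<lambda>c. \<bar>c\<bar> - 1)" by (auto simp: up_down_path_def abs_if)
    fix x
    have "lin_interp (\<lambda>c. \<bar>c\<bar> - 1) y = \<bar>y\<bar> - 1" for y
    proof (cases "y \<ge> 0")
      case True
      then have "\<lfloor>y\<rfloor> \<ge> 0" by simp
      then show ?thesis using True by (simp add: lin_interp_def frac_def algebra_simps)
    next
      case False
      then have "\<lfloor>y\<rfloor> + 1 \<le> 0" by linarith
      then have "\<bar>\<lfloor>y\<rfloor>\<bar> = - \<lfloor>y\<rfloor>" "\<bar>\<lfloor>y\<rfloor> + 1\<bar> = - \<lfloor>y\<rfloor> - 1" by auto
      then show ?thesis using False by (simp add: lin_interp_def frac_def algebra_simps)
    qed
    then show "1 / m * (lin_interp (\<lambda>c. \<bar>c\<bar> - 1) (m * x) + 1) \<le> fbar f x"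
      using abs_le_fbar[OF f, of x] m by (simp add: abs_mult)
  qed
  have "\<exists>G. path_below f n G \<and> (\<forall>G'. path_below f n G' \<longrightarrow> G' c \<le> G c)" for c
  proof -
    define B where "B = \<lceil>m * fbar f (of_int c / m)\<rceil>"
    have B: "G c \<le> B" if "path_below f n G" for G
      using bound[OF that, of c] unfolding B_def by linarith
    obtain G where G: "path_below f n G"
      "\<And>G'. path_below f n G' \<Longrightarrow> nat (B - G c) \<le> nat (B - G' c)"
      using ex_has_least_nat[of "path_below f n" _ "\<lambda>G. nat (B - G c)"] base by blast
    have "G' c \<le> G c" if "path_below f n G'" for G'
      using G(2)[OF that] B[OF G(1)] B[OF that] by linarith
    with G(1) show ?thesis by blast
  qed
  then obtain M where M: "\<And>c. path_below f n (M c)"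
    "\<And>c G. path_below f n G \<Longrightarrow> G c \<le> M c c"
    by metis
  define H where "H = (\<lambda>c. M c c)"
  have stepM: "M c (d + 1) - M c d = 1 \<or> M c (d + 1) - M c d = - 1" for c d
    using up[OF M(1)] unfolding up_down_path_def by blast
  have odd: "odd (H c + c)" for c
    using up[OF M(1)] unfolding up_down_path_def H_def by blast
  have step: "H (c + 1) - H c = 1 \<or> H (c + 1) - H c = - 1" for c
  proof -
    have "M c (c + 1) \<le> H (c + 1)" "M (c + 1) c \<le> H c"
      by (auto simp: H_def intro: M)
    then have "\<bar>H (c + 1) - H c\<bar> \<le> 1"
      using stepM[of c c] stepM[of "c + 1" c] by (auto simp: H_def)
    moreover have "odd (H (c + 1) - H c)"
      using odd[of c] odd[of "c + 1"] by simp
    ultimately show ?thesis by presburger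
  qed
  have attained: "\<exists>G. path_below f n G \<and> G c = H c \<and> G (c + 1) = H (c + 1)" for c
  proof -
    have le: "M c (c + 1) \<le> H (c + 1)" "M (c + 1) c \<le> H c"
      by (auto simp: H_def intro: M)
    from step[of c] show ?thesis
    proof
      assume "H (c + 1) - H c = 1"
      then have "M (c + 1) c = H c" using stepM[of "c + 1" c] le by (auto simp: H_def)
      then show ?thesis using M(1) by (auto simp: H_def)
    next
      assume "H (c + 1) - H c = - 1"
      then have "M c (c + 1) = H (c + 1)" using stepM[of c c] le by (auto simp: H_def)
      then show ?thesis using M(1) by (auto simp: H_def)
    qed
  qed
  have H: "path_below f n H"
    unfolding path_below_def m_def[symmetric]
  proof (intro conjI allI)
    show "up_down_path H" using step odd by (simp add: up_down_path_def)
    fix x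
    obtain G where G: "path_below f n G" "G \<lfloor>m * x\<rfloor> = H \<lfloor>m * x\<rfloor>"
      "G (\<lfloor>m * x\<rfloor> + 1) = H (\<lfloor>m * x\<rfloor> + 1)"
      using attained by blast
    from G(2,3) have "lin_interp H (m * x) = lin_interp G (m * x)"
      by (simp add: lin_interp_def)
    with G(1) show "1 / m * (lin_interp H (m * x) + 1) \<le> fbar f x"
      unfolding path_below_def m_def[symmetric] by metis
  qed
  have le: "G \<le> H" if "path_below f n G" for G
    using that by (auto simp: le_fun_def H_def intro: M)
  have "max_path f n = H"
    unfolding max_path_def using H le by (rule Greatest_equality)
  then show "path_below f n (max_path f n)" "path_below f n G \<Longrightarrow> G \<le> max_path f n"
    using H le by auto
qed

text \<open>The Aztec t-embedding. Values with \<open>j + k + n\<close> even are junk.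
  The last argument of the function below is \<open>n\<close>, so that the third equation computes
  \<open>F(j, k, n + 1)\<close> for \<open>n = Suc m \<ge> 1\<close>; the lemmas after it show that it is the unique
  solution of the defining system.\<close>

fun aztec :: "int \<Rightarrow> int \<Rightarrow> nat \<Rightarrow> complex" where
  "aztec j k 0 = 0"
| "aztec j k (Suc 0) = 0"
| "aztec j k (Suc (Suc m)) =
     (let n = int (Suc m) in
      if \<bar>j\<bar> + \<bar>k\<bar> > n then 0
      else if (j, k) = (n, 0) then (aztec (n - 1) 0 (Suc m) + 1) / 2
      else if (j, k) = (0, n) then (aztec 0 (n - 1) (Suc m) + \<i>) / 2
      else if (j, k) = (- n, 0) then (aztec (- n + 1) 0 (Suc m) - 1) / 2
      else if (j, k) = (0, - n) then (aztec 0 (- n + 1) (Suc m) - \<i>) / 2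
      else (aztec (j + 1) k (Suc m) + aztec (j - 1) k (Suc m)
            + aztec j (k + 1) (Suc m) + aztec j (k - 1) (Suc m)) / 2 - aztec j k m)"

definition aztec_system :: "(int \<Rightarrow> int \<Rightarrow> nat \<Rightarrow> complex) \<Rightarrow> bool" where
  "aztec_system F \<longleftrightarrow>
     (\<forall>j k n. odd (j + k + int n) \<and> \<bar>j\<bar> + \<bar>k\<bar> \<ge> int n \<longrightarrow> F j k n = 0) \<and>
     F 0 0 1 = 0 \<and>
     (\<forall>n\<ge>1.
        F (int n) 0 (n + 1) = 1 / 2 * (F (int n - 1) 0 n + 1) \<and>
        F 0 (int n) (n + 1) = 1 / 2 * (F 0 (int n - 1) n + \<i>) \<and>
        F (- int n) 0 (n + 1) = 1 / 2 * (F (- int n + 1) 0 n - 1) \<and>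
        F 0 (- int n) (n + 1) = 1 / 2 * (F 0 (- int n + 1) n - \<i>)) \<and>
     (\<forall>j k. \<forall>n\<ge>1. even (j + k + int n) \<and> \<bar>j\<bar> + \<bar>k\<bar> \<le> int n \<and>
        (j, k) \<notin> {(int n, 0), (0, int n), (- int n, 0), (0, - int n)} \<longrightarrow>
        F j k (n + 1) + F j k (n - 1)
          = 1 / 2 * (F (j + 1) k n + F (j - 1) k n + F j (k + 1) n + F j (k - 1) n))"

lemma aztec_outside: "\<bar>j\<bar> + \<bar>k\<bar> \<ge> int n \<Longrightarrow> aztec j k n = 0"
  by (cases "(j, k, n)" rule: aztec.cases) auto

lemma aztec_solves: "aztec_system aztec"
  unfolding aztec_system_def
proof (intro conjI allI impI)
  fix n :: nat assume "1 \<le> n"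
  then obtain m where n: "n = Suc m" by (cases n) auto
  show "aztec (int n) 0 (n + 1) = 1 / 2 * (aztec (int n - 1) 0 n + 1)"
    "aztec 0 (int n) (n + 1) = 1 / 2 * (aztec 0 (int n - 1) n + \<i>)"
    "aztec (- int n) 0 (n + 1) = 1 / 2 * (aztec (- int n + 1) 0 n - 1)"
    "aztec 0 (- int n) (n + 1) = 1 / 2 * (aztec 0 (- int n + 1) n - \<i>)"
    by (simp_all add: n Let_def)
next
  fix j k :: int and n :: nat assume "1 \<le> n"
  then obtain m where n: "n = Suc m" by (cases n) auto
  assume "even (j + k + int n) \<and> \<bar>j\<bar> + \<bar>k\<bar> \<le> int n \<and>
     (j, k) \<notin> {(int n, 0), (0, int n), (- int n, 0), (0, - int n)}"
  then show "aztec j k (n + 1) + aztec j k (n - 1) = 1 / 2 * (aztec (j + 1) k n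
      + aztec (j - 1) k n + aztec j (k + 1) n + aztec j (k - 1) n)"
    by (auto simp: n Let_def)
qed (auto simp: aztec_outside)

lemma aztec_unique:
  assumes F: "aztec_system F" and "odd (j + k + int n)"
  shows "F j k n = aztec j k n"
  using assms(2)
proof (induction n arbitrary: j k rule: less_induct)
  case (less l)
  note IH = less.IH and prem = less.prems
  have out: "G j k l = 0" if "aztec_system G" "\<bar>j\<bar> + \<bar>k\<bar> \<ge> int l" for G
    using that prem unfolding aztec_system_def by blast
  show ?case
  proof (cases "l \<le> 1")
    case True
    show ?thesis
    proof (cases "\<bar>j\<bar> + \<bar>k\<bar> \<ge> int l")
      case True
      then show ?thesis using out F aztec_solves by metis
    next
      case False
      with \<open>l \<le> 1\<close> have "j = 0" "k = 0" "l = 1" by auto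
      then show ?thesis using F aztec_solves unfolding aztec_system_def by metis
    qed
  next
    case False
    then obtain n where l: "l = n + 1" and n1: "n \<ge> 1"
      by (metis Suc_eq_plus1 not_less_eq_eq One_nat_def le_SucE nat_le_linear not0_implies_Suc)
    have corner: "G (int n) 0 (n + 1) = 1 / 2 * (G (int n - 1) 0 n + 1) \<and>
        G 0 (int n) (n + 1) = 1 / 2 * (G 0 (int n - 1) n + \<i>) \<and>
        G (- int n) 0 (n + 1) = 1 / 2 * (G (- int n + 1) 0 n - 1) \<and>
        G 0 (- int n) (n + 1) = 1 / 2 * (G 0 (- int n + 1) n - \<i>)"
      if "aztec_system G" for G
      using that n1 unfolding aztec_system_def by blast
    have rec: "G j k (n + 1) + G j k (n - 1)
          = 1 / 2 * (G (j + 1) k n + G (j - 1) k n + G j (k + 1) n + G j (k - 1) n)"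
      if "aztec_system G" "even (j + k + int n)" "\<bar>j\<bar> + \<bar>k\<bar> \<le> int n"
        "(j, k) \<notin> {(int n, 0), (0, int n), (- int n, 0), (0, - int n)}" for G
      using that n1 unfolding aztec_system_def by blast
    have ev: "even (j + k + int n)" using prem by (simp add: l)
    have IHn: "F j' k' n = aztec j' k' n" if "odd (j' + k' + int n)" for j' k'
      using IH[of n j' k'] that by (simp add: l)
    have IHm: "F j k (n - 1) = aztec j k (n - 1)"
      using IH[of "n - 1" j k] ev n1 by (simp add: l of_nat_diff)
    consider "\<bar>j\<bar> + \<bar>k\<bar> > int n" | "j = int n" "k = 0" | "j = 0" "k = int n"
      | "j = - int n" "k = 0" | "j = 0" "k = - int n"
      | "\<bar>j\<bar> + \<bar>k\<bar> \<le> int n"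
        "(j, k) \<notin> {(int n, 0), (0, int n), (- int n, 0), (0, - int n)}"
      by (metis empty_iff insert_iff not_less prod.inject)
    then show ?thesis
    proof cases
      case 1
      then have "\<bar>j\<bar> + \<bar>k\<bar> \<ge> int l" by (simp add: l)
      then show ?thesis using out F aztec_solves by metis
    next
      case 2
      then show ?thesis
        using corner[OF F] corner[OF aztec_solves] IHn[of "int n - 1" 0]
        by (simp del: One_nat_def aztec.simps add: l) (metis mult_cancel_right zero_neq_numeral)
    next
      case 3
      then show ?thesis
        using corner[OF F] corner[OF aztec_solves] IHn[of 0 "int n - 1"]
        by (simp del: One_nat_def aztec.simps add: l) (metis mult_cancel_right zero_neq_numeral)
    next
      case 4
      then show ?thesis
        using corner[OF F] corner[OF aztec_solves] IHn[of "- int n + 1" 0]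
        by (simp del: One_nat_def aztec.simps add: l) (metis mult_cancel_right zero_neq_numeral)
    next
      case 5
      then show ?thesis
        using corner[OF F] corner[OF aztec_solves] IHn[of 0 "- int n + 1"]
        by (simp del: One_nat_def aztec.simps add: l) (metis mult_cancel_right zero_neq_numeral)
    next
      case 6
      have "F (j + 1) k n = aztec (j + 1) k n" "F (j - 1) k n = aztec (j - 1) k n"
        "F j (k + 1) n = aztec j (k + 1) n" "F j (k - 1) n = aztec j (k - 1) n"
        using ev by (auto intro!: IHn)
      then show ?thesis
        using rec[OF F ev 6] rec[OF aztec_solves ev 6] IHm l by (metis add_right_cancel)
    qed
  qed
qed

text \<open>The t-embedding of the reduced generalized tower graph of rank \<open>n + 1\<close>. For admissible \<open>f\<close> the path is
  at least \<open>|c| - 1\<close>, so that the truncation by \<open>nat\<close> only replaces the level \<open>-1\<close> by \<open>0\<close>;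
  \<open>F\<close> vanishes at both.\<close>

definition t_emb :: "(real \<Rightarrow> real) \<Rightarrow> nat \<Rightarrow> int \<times> int \<Rightarrow> complex" where
  "t_emb f n = (\<lambda>(j, k). aztec j k (nat (max_path f (n + 1) (j + k))))"

definition hexagonal_column :: "(real \<Rightarrow> real) \<Rightarrow> nat \<Rightarrow> int \<Rightarrow> bool" where
  "hexagonal_column f n c \<longleftrightarrow>
     (let H = max_path f (n + 1) in
        (H (c - 1) \<le> H c \<and> H c \<le> H (c + 1)) \<or> (H (c - 1) \<ge> H c \<and> H c \<ge> H (c + 1)))"

text \<open>The directions of the dual edges at a face of column \<open>c\<close>, in counterclockwise order.\<close>

definition directions :: "(real \<Rightarrow> real) \<Rightarrow> nat \<Rightarrow> int \<Rightarrow> (int \<times> int) list" where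
  "directions f n c =
     (if hexagonal_column f n c
      then [(1, 0), (0, 1), (- 1, 1), (- 1, 0), (0, - 1), (1, - 1)]
      else [(1, 0), (0, 1), (- 1, 0), (0, - 1)])"

text \<open>\<open>consecutive f n c d d'\<close>: the direction \<open>d'\<close> is the cyclic successor of \<open>d\<close>. The two edges in
  these directions bound a common face of the embedding, which lies to the left of the first
  and to the right of the second.\<close>

definition consecutive :: "(real \<Rightarrow> real) \<Rightarrow> nat \<Rightarrow> int \<Rightarrow> int \<times> int \<Rightarrow> int \<times> int \<Rightarrow> bool" where
  "consecutive f n c d d' \<longleftrightarrow>
     (d, d') \<in> set (zip (directions f n c) (rotate1 (directions f n c)))"

definition dt_emb :: "(real \<Rightarrow> real) \<Rightarrow> nat \<Rightarrow> int \<times> int \<Rightarrow> int \<times> int \<Rightarrow> complex" where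
  "dt_emb f n p d = t_emb f n (p + d) - t_emb f n p"

text \<open>The interior angle of the face between two consecutive edges: the angle from the first
  edge to its counterclockwise successor, normalised to \<open>(-pi, pi]\<close>. It is \<open>0\<close> if one of the
  edges is degenerate. Whenever it is nonnegative it is also the unoriented angle in \<open>[0, pi]\<close>
  between the two edges.\<close>

definition face_angle :: "(real \<Rightarrow> real) \<Rightarrow> nat \<Rightarrow> int \<times> int \<Rightarrow> int \<times> int \<Rightarrow> int \<times> int \<Rightarrow> real" where
  "face_angle f n p d d' = Arg (dt_emb f n p d' / dt_emb f n p d)"

definition rescaled_point :: "nat \<Rightarrow> int \<times> int \<Rightarrow> real \<times> real" where
  "rescaled_point n = (\<lambda>(j, k). (1 / (real n + 1)) *\<^sub>R (of_int j, of_int k))"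

definition rescaled_edge :: "nat \<Rightarrow> int \<times> int \<Rightarrow> int \<times> int \<Rightarrow> (real \<times> real) set" where
  "rescaled_edge n p d = closed_segment (rescaled_point n p) (rescaled_point n (p + d))"

end

theory Submission
  imports Defs
begin

text \<open>The differences of \<open>F\<close> between a point and its four neighbours one level up factor exactly:
  east, north, west and south are \<open>a b\<close>, \<open>c b\<close>, \<open>c d\<close> and \<open>- a d\<close>, where \<open>a, b, c, d\<close> are complex
  combinations of two neighbouring Krawtchouk numbers. The wave equation for \<open>F\<close> turns into the
  Pascal-type recurrences of these numbers. Every angle of the t-embedding is then the argument of
  a real Moebius transform of \<open>c / a\<close> or \<open>d / b\<close>. The imaginary part of such a ratio is a Turan
  determinant \<open>y\<^sup>2 - x z\<close> of consecutive Krawtchouk numbers, divided by a squared norm; the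
  three-term recurrence makes it a quadratic form that is uniformly positive definite in the bulk
  of the liquid region, so the ratios stay in a compact part of the upper half plane. No
  asymptotics are needed. The function \<open>f\<close> enters only through the lower bound
  \<open>H(c) \<ge> (n + 2) f(c / (n + 2)) - 3\<close>.\<close>

section \<open>Krawtchouk numbers\<close>

text \<open>\<open>kraw p q u\<close> is the coefficient of \<open>w\<^sup>u\<close> in \<open>(w + 1/w)\<^sup>p (w - 1/w)\<^sup>q\<close>, a Krawtchouk number
  up to reindexing.\<close>

fun kraw :: "nat \<Rightarrow> nat \<Rightarrow> int \<Rightarrow> real" where
  "kraw 0 0 u = (if u = 0 then 1 else 0)"
| "kraw (Suc p) q u = kraw p q (u - 1) + kraw p q (u + 1)"
| "kraw 0 (Suc q) u = kraw 0 q (u - 1) - kraw 0 q (u + 1)"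

text \<open>Multiplications by \<open>w + 1/w\<close> and by \<open>w - 1/w\<close> commute, so the
  recursion in \<open>q\<close>, which defines the numbers only at \<open>p = 0\<close>, holds for
  every \<open>p\<close>.\<close>

lemma kraw_Suc_right: "kraw p (Suc q) u = kraw p q (u - 1) - kraw p q (u + 1)"
proof (induction p arbitrary: u)
  case (Suc p)
  show ?case using Suc[of "u - 1"] Suc[of "u + 1"] by simp
qed simp

lemma kraw_eq_0: "int (p + q) < \<bar>u\<bar> \<Longrightarrow> kraw p q u = 0"
  by (induction p q u rule: kraw.induct) auto

lemma kraw_top: "kraw p q (int (p + q)) = 1"
proof (induction p q "int (p + q)" rule: kraw.induct)
  case (2 p q)
  then show ?case by (simp add: kraw_eq_0 algebra_simps)
next
  case (3 q)
  then show ?case by (simp add: kraw_eq_0 algebra_simps)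
qed simp

text \<open>The generating function \<open>g = (w + 1/w)^p (w - 1/w)^q\<close> satisfies
  \<open>(w^2 - w^(-2)) w g' = ((p + q) (w^2 + w^(-2)) - 2 (p - q)) g\<close>. This is its
  coefficient at \<open>w^u\<close>, checked by induction.\<close>

lemma kraw_three_term:
  "(real (p + q) + 2 - u) * kraw p q (u - 2) + (real (p + q) + 2 + u) * kraw p q (u + 2)
     = 2 * (real p - real q) * kraw p q u"
proof (induction p q u rule: kraw.induct)
  case (1 u)
  then show ?case by auto
next
  case (2 p q u)
  show ?case using 2 by (simp add: algebra_simps)
next
  case (3 q u)
  show ?case using 3 by (simp add: algebra_simps)
qed

text \<open>Two neighbouring zeros would propagate upwards through the three-term recurrence, whose
  leading coefficient stays positive, and reach the top coefficient, which is 1. The parity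
  assumption makes steps of 2 hit the top.\<close>

lemma kraw_not_both_0:
  assumes "even (u + int (p + q))" "\<bar>u\<bar> \<le> int (p + q)"
  shows "kraw p q u \<noteq> 0 \<or> kraw p q (u + 2) \<noteq> 0"
proof (rule ccontr)
  assume H: "\<not> ?thesis"
  have "kraw p q (u + 2 * int i) = 0 \<and> kraw p q (u + 2 * int i + 2) = 0" for i
  proof (induction i)
    case (Suc i)
    have "(real (p + q) + 2 + (u + 2 * int i + 2)) * kraw p q (u + 2 * int i + 2 + 2) = 0"
      using kraw_three_term[of p q "u + 2 * int i + 2"] Suc by simp
    moreover have "real (p + q) + 2 + (u + 2 * int i + 2) > 0" using assms(2) by linarith
    ultimately have "kraw p q (u + 2 * int i + 2 + 2) = 0" by (metis less_irrefl mult_eq_0_iff)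
    then show ?case using Suc by (simp add: algebra_simps)
  qed (use H in simp)
  moreover obtain i where "u + 2 * int i = int (p + q)"
  proof
    show "u + 2 * int (nat ((int (p + q) - u) div 2)) = int (p + q)" using assms by auto
  qed
  ultimately show False using kraw_top[of p q] by (metis zero_neq_one)
qed

text \<open>Replacing \<open>w\<close> by \<open>\<i>/w\<close> exchanges the two factors of the
  generating function up to powers of \<open>\<i>\<close>; the form of \<open>u\<close> makes the
  total power a sign.\<close>

lemma kraw_dual:
  "u = 2 * a - int (p + q) \<Longrightarrow>
    kraw q p u = (if even (int p + a) then 1 else - 1) * kraw p q (- u)"
proof (induction p q u arbitrary: a rule: kraw.induct)
  case (2 p q u)
  have "kraw q p (u - 1) = (if even (int p + (a - 1)) then 1 else - 1) * kraw p q (- (u - 1))"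
    "kraw q p (u + 1) = (if even (int p + a) then 1 else - 1) * kraw p q (- (u + 1))"
    by (rule 2(1), use 2(3) in simp) (rule 2(2), use 2(3) in simp)
  then show ?case by (auto simp: kraw_Suc_right)
next
  case (3 q u)
  have "kraw q 0 (u - 1) = (if even (int 0 + (a - 1)) then 1 else - 1) * kraw 0 q (- (u - 1))"
    "kraw q 0 (u + 1) = (if even (int 0 + a) then 1 else - 1) * kraw 0 q (- (u + 1))"
    by (rule 3(1), use 3(3) in simp) (rule 3(2), use 3(3) in simp)
  then show ?case by auto
qed auto

text \<open>Packing two neighbours into one complex number makes the Turan determinant an imaginary
  part: that of \<open>kpair p q (u - 1) * cnj (kpair p q (u + 1))\<close>.\<close>

definition kpair :: "nat \<Rightarrow> nat \<Rightarrow> int \<Rightarrow> complex" where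
  "kpair p q u = Complex (kraw p q (u - 1)) (kraw p q (u + 1))"

lemma kpair_Suc:
  "kpair (Suc p) q u = kpair p q (u - 1) + kpair p q (u + 1)"
  "kpair p (Suc q) u = kpair p q (u - 1) - kpair p q (u + 1)"
  by (simp_all add: kpair_def complex_eq_iff kraw_Suc_right algebra_simps)

lemma kpair_top: "u = int (p + q) + 1 \<Longrightarrow> kpair p q u = 1"
  using kraw_top[of p q] by (simp add: kpair_def complex_eq_iff kraw_eq_0)

text \<open>The reflection of \<open>u\<close> swaps the two coordinates, and the signs of
  \<open>kraw_dual\<close> alternate between neighbours; together this is multiplication by
  \<open>\<i>\<close>, up to sign.\<close>

lemma kpair_dual:
  assumes "u = 2 * int a - int (p + q) - 1"
  shows "kpair q p u = (- 1) ^ (p + a) * \<i> * kpair p q (- u)"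
proof -
  have "kraw q p (u + 1) = (if even (int p + int a) then 1 else - 1) * kraw p q (- (u + 1))"
    "kraw q p (u - 1) = (if even (int p + (int a - 1)) then 1 else - 1) * kraw p q (- (u - 1))"
    by (rule kraw_dual, use assms in simp)+
  then show ?thesis by (auto simp: kpair_def complex_eq_iff uminus_power_if)
qed

section \<open>Uniform bounds for ratios of Krawtchouk pairs\<close>

definition uhp_compact :: "real \<Rightarrow> complex set" where
  "uhp_compact e = {z. e \<le> Im z \<and> e * cmod z \<le> 1}"

text \<open>With \<open>x, y, z\<close> three consecutive Krawtchouk numbers, \<open>y\<^sup>2 - x z\<close> becomes through the
  recurrence a binary quadratic form whose discriminant is negative exactly inside the arctic
  circle, uniformly so under the bound on \<open>s\<close>.\<close>

lemma turan_bound: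
  fixes x y z :: real
  assumes d: "0 < d" "d \<le> 1" and P: "0 < P" "P \<le> M" and R: "0 < R" "R \<le> M"
    and rec: "R * x + P * z = s * y"
    and s: "s\<^sup>2 \<le> 4 * (1 - d) * (P * R)" and M: "d * M\<^sup>2 \<le> 4 * (P * R)"
  shows "d\<^sup>2 / 24 * (x\<^sup>2 + y\<^sup>2) \<le> y\<^sup>2 - x * z" "d\<^sup>2 / 24 * (y\<^sup>2 + z\<^sup>2) \<le> y\<^sup>2 - x * z"
proof -
  define Q where "Q = y\<^sup>2 - x * z"
  have PR: "0 < P * R" using P R by simp
  \<comment> \<open>The inequality between arithmetic and geometric means bounds \<open>x z\<close>
    by \<open>(1 - d) y^2\<close>, hence the determinant \<open>Q\<close> from below by
    \<open>d y^2\<close>.\<close>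
  have "4 * (P * R) * (x * z) \<le> (R * x + P * z)\<^sup>2"
    using zero_le_power2[of "R * x - P * z"] by (simp add: power2_eq_square algebra_simps)
  also have "\<dots> = s\<^sup>2 * y\<^sup>2" by (simp add: rec power_mult_distrib)
  also have "\<dots> \<le> 4 * (1 - d) * (P * R) * y\<^sup>2" using s by (intro mult_right_mono) auto
  finally have "(P * R) * (x * z) \<le> (P * R) * ((1 - d) * y\<^sup>2)" by (simp add: algebra_simps)
  then have "x * z \<le> (1 - d) * y\<^sup>2" using PR mult_le_cancel_left_pos by blast
  then have Qy: "d * y\<^sup>2 \<le> Q" by (simp add: Q_def algebra_simps)
  then have Q0: "0 \<le> Q" using d by (smt (verit) mult_nonneg_nonneg zero_le_power2)
  have sy: "s\<^sup>2 * y\<^sup>2 \<le> 4 * (P * R) * y\<^sup>2"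
  proof (rule mult_right_mono)
    have "4 * (1 - d) * (P * R) \<le> 4 * 1 * (P * R)" using d PR by (intro mult_right_mono) auto
    with s show "s\<^sup>2 \<le> 4 * (P * R)" by simp
  qed simp
  \<comment> \<open>It remains to dominate \<open>x\<close> and \<open>z\<close> by
    \<open>Q\<close>. Squaring the recurrence bounds their weighted squares by
    \<open>y^2 + Q\<close>, and \<open>Q\<close> already dominates \<open>d y^2\<close>.\<close>
  have "R\<^sup>2 * x\<^sup>2 + P\<^sup>2 * z\<^sup>2 = (R * x + P * z)\<^sup>2 + 2 * (P * R) * Q - 2 * (P * R) * y\<^sup>2"
    by (simp add: Q_def power2_eq_square algebra_simps)
  also have "\<dots> \<le> 4 * (P * R) * y\<^sup>2 + 2 * (P * R) * Q - 2 * (P * R) * y\<^sup>2"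
    using sy by (simp add: rec power_mult_distrib)
  also have "\<dots> = 2 * (P * R) * (y\<^sup>2 + Q)" by (simp add: algebra_simps)
  finally have xz: "R\<^sup>2 * x\<^sup>2 + P\<^sup>2 * z\<^sup>2 \<le> 2 * (P * R) * (y\<^sup>2 + Q)" .
  have yQ: "d * (y\<^sup>2 + Q) \<le> 2 * Q"
    using Qy mult_right_mono[of d 1 Q] d Q0 by (simp add: algebra_simps)
  \<comment> \<open>Used for \<open>x\<close> with \<open>(A, B) = (P, R)\<close> and for
    \<open>z\<close> with \<open>(R, P)\<close>. As \<open>A \<le> M\<close>, the bound on
    \<open>d M^2\<close> forces \<open>B \<ge> d M / 4\<close>, so the weight \<open>B\<close> can
    be divided out.\<close>
  have aux: "d\<^sup>2 * w\<^sup>2 \<le> 16 * Q"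
    if A: "0 < A" "A \<le> M" and B: "0 < B" "B \<le> M" and AB: "A * B = P * R"
      and w: "B\<^sup>2 * w\<^sup>2 \<le> 2 * (A * B) * (y\<^sup>2 + Q)" for A B w
  proof -
    have "M * (d * M) \<le> 4 * (A * B)"
      using M by (simp add: AB power2_eq_square algebra_simps)
    also have "\<dots> \<le> M * (4 * B)" using A B mult_right_mono[of A M B] by simp
    finally have "M * (d * M) \<le> M * (4 * B)" .
    then have dM: "d * M \<le> 4 * B" using A by (smt (verit) mult_le_cancel_left_pos)
    have "B * (B * w\<^sup>2) \<le> B * (2 * A * (y\<^sup>2 + Q))" using w by (simp add: power2_eq_square algebra_simps)
    then have "B * w\<^sup>2 \<le> 2 * A * (y\<^sup>2 + Q)" using B mult_le_cancel_left_pos by blast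
    also have "\<dots> \<le> 2 * M * (y\<^sup>2 + Q)" using A Q0 by (intro mult_right_mono) auto
    finally have 1: "B * w\<^sup>2 \<le> 2 * M * (y\<^sup>2 + Q)" .
    have "M * (d * w\<^sup>2) \<le> 4 * (B * w\<^sup>2)"
      using mult_right_mono[OF dM, of "w\<^sup>2"] by (simp add: algebra_simps)
    also have "\<dots> \<le> M * (8 * (y\<^sup>2 + Q))" using 1 by (simp add: algebra_simps)
    finally have "d * w\<^sup>2 \<le> 8 * (y\<^sup>2 + Q)" using A by (smt (verit) mult_le_cancel_left_pos)
    then have "d * (d * w\<^sup>2) \<le> d * (8 * (y\<^sup>2 + Q))" using d by (intro mult_left_mono) auto
    also have "\<dots> \<le> 16 * Q" using yQ by (simp add: algebra_simps)
    finally show ?thesis by (simp add: power2_eq_square)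
  qed
  have "R\<^sup>2 * x\<^sup>2 \<le> 2 * (P * R) * (y\<^sup>2 + Q)" "P\<^sup>2 * z\<^sup>2 \<le> 2 * (R * P) * (y\<^sup>2 + Q)"
    using xz zero_le_power2[of "P * z"] zero_le_power2[of "R * x"]
    unfolding power_mult_distrib mult.commute[of R P] by linarith+
  then have "d\<^sup>2 * x\<^sup>2 \<le> 16 * Q" "d\<^sup>2 * z\<^sup>2 \<le> 16 * Q"
    using aux[of P R x] aux[of R P z] P R by auto
  moreover have "d\<^sup>2 * y\<^sup>2 \<le> Q"
  proof -
    have "d * (d * y\<^sup>2) \<le> 1 * (d * y\<^sup>2)" using d by (intro mult_right_mono) auto
    with Qy show ?thesis unfolding power2_eq_square[of d] mult.assoc by linarith
  qed
  \<comment> \<open>The bounds add up to \<open>16 + 1 = 17\<close>, and 24 leaves room.\<close>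
  ultimately show "d\<^sup>2 / 24 * (x\<^sup>2 + y\<^sup>2) \<le> y\<^sup>2 - x * z" "d\<^sup>2 / 24 * (y\<^sup>2 + z\<^sup>2) \<le> y\<^sup>2 - x * z"
    using Q0 by (simp_all add: Q_def[symmetric] algebra_simps)
qed

text \<open>The determinant is the numerator of the imaginary part of the ratio \<open>r\<close>.
  Compared with the norm of the denominator it bounds \<open>Im r\<close> from below; compared with
  that of the numerator it gives \<open>e |r|^2 \<le> Im r \<le> |r|\<close>, which bounds the
  modulus.\<close>

lemma kpair_ratio:
  assumes d: "0 < d" "d \<le> 1" and par: "even (u + int (p + q))"
    and bulk: "(real p - real q)\<^sup>2 + (real_of_int u)\<^sup>2 \<le> (1 - d) * (real (p + q))\<^sup>2"
  shows "kpair p q (u + 1) \<noteq> 0" "kpair p q (u - 1) / kpair p q (u + 1) \<in> uhp_compact (d\<^sup>2 / 24)"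
proof -
  define m where "m = real (p + q)"
  define x y z where "x = kraw p q (u - 2)" and "y = kraw p q u" and "z = kraw p q (u + 2)"
  define M where "M = m + 2"
  define P R where "P = M + u" and "R = M - u"
  note bulk = bulk[folded m_def]
  have m0: "0 \<le> m" by (simp add: m_def)
  have "(real_of_int u)\<^sup>2 \<le> (1 - d) * m\<^sup>2" using bulk zero_le_power2[of "real p - real q"] by linarith
  also have "\<dots> \<le> 1 * m\<^sup>2" using d by (intro mult_right_mono) auto
  finally have "\<bar>real_of_int u\<bar> \<le> m" using m0 by (simp add: abs_le_square_iff[symmetric])
  then have um: "- m \<le> u" "u \<le> m" and ui: "\<bar>u\<bar> \<le> int (p + q)" unfolding m_def by linarith+
  have PR: "P * R = M\<^sup>2 - (real_of_int u)\<^sup>2" by (simp add: P_def R_def power2_eq_square algebra_simps)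
  have mM: "(1 - d) * m\<^sup>2 \<le> (1 - d) * M\<^sup>2"
    using d m0 by (intro mult_left_mono power_mono) (auto simp: M_def)
  have nn: "d * (real_of_int u)\<^sup>2 \<ge> 0" using d by simp
  have pos: "0 < P" "P \<le> 2 * M" "0 < R" "R \<le> 2 * M" using um by (auto simp: P_def R_def M_def)
  have rec: "R * x + P * z = (2 * (real p - real q)) * y"
    using kraw_three_term[of p q u] by (simp add: P_def R_def M_def m_def x_def y_def z_def algebra_simps)
  have s: "(2 * (real p - real q))\<^sup>2 \<le> 4 * (1 - d) * (P * R)"
    using bulk mM nn unfolding PR power_mult_distrib by (simp add: algebra_simps)
  have M2: "d * (2 * M)\<^sup>2 \<le> 4 * (P * R)"
  proof -
    have "d * (2 * M)\<^sup>2 = 4 * (d * M\<^sup>2)" by (simp add: power_mult_distrib)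
    moreover have "d * M\<^sup>2 \<le> P * R"
      using bulk mM zero_le_power2[of "real p - real q"] unfolding PR left_diff_distrib by linarith
    ultimately show ?thesis by simp
  qed
  note t = turan_bound[OF d pos rec s M2]
  have k: "kpair p q (u + 1) = Complex y z" "kpair p q (u - 1) = Complex x y"
    by (simp_all add: kpair_def x_def y_def z_def add.commute)
  have yz: "y \<noteq> 0 \<or> z \<noteq> 0" using kraw_not_both_0[OF par ui] by (simp add: y_def z_def)
  then show nz: "kpair p q (u + 1) \<noteq> 0" by (simp add: k complex_eq_iff)
  have yz0: "0 < y\<^sup>2 + z\<^sup>2" using yz by (simp add: sum_power2_gt_zero_iff)
  let ?e = "d\<^sup>2 / 24"
  let ?r = "Complex x y / Complex y z"
  have im: "Im ?r = (y\<^sup>2 - x * z) / (y\<^sup>2 + z\<^sup>2)"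
    by (simp add: Im_divide power2_eq_square)
  have "?e \<le> Im ?r" using t(2) yz0 by (simp add: im pos_le_divide_eq)
  moreover have "?e * cmod ?r \<le> 1"
  proof -
    have r2: "(cmod ?r)\<^sup>2 = (x\<^sup>2 + y\<^sup>2) / (y\<^sup>2 + z\<^sup>2)"
      by (simp add: norm_divide power_divide cmod_power2)
    have "?e * (cmod ?r)\<^sup>2 \<le> Im ?r" using divide_right_mono[OF t(1), of "y\<^sup>2 + z\<^sup>2"] yz0
      unfolding r2 im by simp
    also have "\<dots> \<le> cmod ?r" using abs_Im_le_cmod[of ?r] by linarith
    finally have "cmod ?r * (?e * cmod ?r) \<le> cmod ?r * 1" by (simp add: power2_eq_square algebra_simps)
    then show ?thesis
      using mult_left_le_imp_le[of "cmod ?r" "?e * cmod ?r" 1] by (cases "?r = 0") auto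
  qed
  ultimately show "kpair p q (u - 1) / kpair p q (u + 1) \<in> uhp_compact (d\<^sup>2 / 24)"
    by (simp add: k uhp_compact_def)
qed

section \<open>Product formula for the Aztec t-embedding\<close>

text \<open>A quarter turn preserves the recurrence and permutes the corner data
  \<open>1, \<i>, -1, -\<i>\<close> cyclically, which is multiplication by
  \<open>\<i>\<close>.\<close>

lemma aztec_rot: "aztec (- k) j n = \<i> * aztec j k n"
proof (induction j k n rule: aztec.induct)
  case (3 j k m)
  define n where "n = int (Suc m)"
  have n: "n > 0" by (simp add: n_def)
  note IH = 3[OF n_def]
  consider "\<bar>j\<bar> + \<bar>k\<bar> > n" | "(j, k) = (n, 0)" | "(j, k) = (0, n)" | "(j, k) = (- n, 0)"
    | "(j, k) = (0, - n)" | "\<not> \<bar>j\<bar> + \<bar>k\<bar> > n" "(j, k) \<notin> {(n, 0), (0, n), (- n, 0), (0, - n)}"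
    by blast
  then show ?case
  proof cases
    case 6
    then have ne: "(j, k) \<noteq> (n, 0)" "(j, k) \<noteq> (0, n)" "(j, k) \<noteq> (- n, 0)" "(j, k) \<noteq> (0, - n)" by auto
    note IH' = IH(5-9)[OF 6(1) ne]
    have ne': "(- k, j) \<noteq> (n, 0)" "(- k, j) \<noteq> (0, n)" "(- k, j) \<noteq> (- n, 0)" "(- k, j) \<noteq> (0, - n)"
      "\<not> \<bar>- k\<bar> + \<bar>j\<bar> > n" using ne 6(1) by auto
    have *: "- (k + 1) = - k - 1" "- (k - 1) = - k + 1" by auto
    note IH'' = IH'[unfolded *]
    show ?thesis
      unfolding aztec.simps(3) Let_def n_def[symmetric] if_not_P[OF 6(1)] if_not_P[OF ne(1)]
        if_not_P[OF ne(2)] if_not_P[OF ne(3)] if_not_P[OF ne(4)] if_not_P[OF ne'(1)]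
        if_not_P[OF ne'(2)] if_not_P[OF ne'(3)] if_not_P[OF ne'(4)] if_not_P[OF ne'(5)] IH''
      by (simp add: algebra_simps)
  qed (use n IH in \<open>auto simp: Let_def n_def[symmetric] algebra_simps simp del: of_nat_Suc\<close>)
qed auto

text \<open>The increments are taken at points with \<open>|j| + |k| \<le> m\<close> and \<open>j + k + m\<close> even; note the shift, the
  level of the point being \<open>m + 1\<close>.\<close>

definition dE :: "int \<Rightarrow> int \<Rightarrow> nat \<Rightarrow> complex" where
  "dE j k m = aztec (j + 1) k (m + 2) - aztec j k (m + 1)"

definition dN :: "int \<Rightarrow> int \<Rightarrow> nat \<Rightarrow> complex" where
  "dN j k m = aztec j (k + 1) (m + 2) - aztec j k (m + 1)"

definition dW :: "int \<Rightarrow> int \<Rightarrow> nat \<Rightarrow> complex" where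
  "dW j k m = aztec (j - 1) k (m + 2) - aztec j k (m + 1)"

definition dS :: "int \<Rightarrow> int \<Rightarrow> nat \<Rightarrow> complex" where
  "dS j k m = aztec j (k - 1) (m + 2) - aztec j k (m + 1)"

text \<open>Quarter turns reduce the other three increments to the eastern one, so that only
  \<open>dE\<close> needs its own recurrence.\<close>

lemma increment_rot: "dN j k m = \<i> * dE k (- j) m" "dW j k m = \<i> * dN k (- j) m"
    "dS j k m = \<i> * dW k (- j) m"
  using aztec_rot[of "- j" "k + 1" "m + 2"] aztec_rot[of "- j" k "m + 1"]
    aztec_rot[of "1 - j" k "m + 2"] aztec_rot[of "- j" "k - 1" "m + 2"]
  by (simp_all add: dE_def dN_def dW_def dS_def algebra_simps del: aztec.simps)

section \<open>Recurrences for the eastern increment\<close>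

lemma aztec_rec:
  assumes "\<bar>j\<bar> + \<bar>k\<bar> \<le> int m + 1"
    "(j, k) \<notin> {(int m + 1, 0), (0, int m + 1), (- int m - 1, 0), (0, - int m - 1)}"
  shows "aztec j k (m + 2) = (aztec (j + 1) k (m + 1) + aztec (j - 1) k (m + 1)
    + aztec j (k + 1) (m + 1) + aztec j (k - 1) (m + 1)) / 2 - aztec j k m"
proof -
  have "\<not> \<bar>j\<bar> + \<bar>k\<bar> > int (Suc m)" "(j, k) \<noteq> (int (Suc m), 0)" "(j, k) \<noteq> (0, int (Suc m))"
     "(j, k) \<noteq> (- int (Suc m), 0)" "(j, k) \<noteq> (0, - int (Suc m))"
    using assms by auto
  then show ?thesis by (simp only: Let_def add_2_eq_Suc' Suc_eq_plus1[symmetric] aztec.simps(3) if_False)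
qed

lemma aztec_corner: "aztec (int m + 1) 0 (m + 2) = (aztec (int m) 0 (m + 1) + 1) / 2"
  by (simp add: add_2_eq_Suc' Let_def)

text \<open>This is the wave equation at the eastern neighbour. Subtracting the value at
  \<open>(j, k)\<close>, which is the western term there, reverses the sign of
  \<open>dW\<close>.\<close>

lemma dE_rec_inner:
  assumes "\<bar>j + 1\<bar> + \<bar>k\<bar> \<le> int m"
  shows "dE j k (Suc m) = (dE (j + 1) k m + dN (j + 1) k m + dS (j + 1) k m - dW (j + 1) k m) / 2"
proof -
  have "(j + 1, k) \<notin> {(int (m + 1) + 1, 0), (0, int (m + 1) + 1), (- int (m + 1) - 1, 0), (0, - int (m + 1) - 1)}"
    using assms by auto
  from aztec_rec[OF _ this] assms show ?thesis
    by (simp add: dE_def dN_def dW_def dS_def field_simps del: aztec.simps)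
qed

text \<open>On a side of the diamond the values outside and at the previous level vanish, so only
  two increments survive; at the eastern corner just one.\<close>

lemma dE_rec_NE:
  assumes "0 \<le> j" "0 < k" "j + k = int m + 1"
  shows "dE j k (Suc m) = (dE j (k - 1) m - dN j (k - 1) m) / 2"
  using aztec_rec[of "j + 1" k "m + 1"] assms
  by (simp add: dE_def dN_def aztec_outside field_simps del: aztec.simps)

lemma dE_rec_SE:
  assumes "0 \<le> j" "k < 0" "j - k = int m + 1"
  shows "dE j k (Suc m) = (dE j (k + 1) m - dS j (k + 1) m) / 2"
  using aztec_rec[of "j + 1" k "m + 1"] assms
  by (simp add: dE_def dS_def aztec_outside field_simps del: aztec.simps)

lemma dE_rec_corner: "dE (int m + 1) 0 (Suc m) = dE (int m) 0 m / 2"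
  using aztec_corner[of m] aztec_corner[of "m + 1"]
  by (simp add: dE_def field_simps del: aztec.simps)

text \<open>Each step of the recurrence contributes a factor 1/2, and \<open>dE 0 0 0 = 1/2\<close>
  one more.\<close>

definition coeff_sign :: "nat \<Rightarrow> nat \<Rightarrow> complex" where
  "coeff_sign q m = (- 1) ^ q / 2 ^ Suc m"

text \<open>The four nonnegative numbers \<open>P, P', Q, Q'\<close> are the distances of \<open>(j, k)\<close> to the sides of the
  diamond: \<open>P - P' = j + k\<close> and \<open>Q - Q' = j - k\<close>. A quarter turn permutes them cyclically, and
  \<open>kpair_dual\<close> says that the product formula is invariant under it.\<close>

lemma increments_of_dE:
  assumes E: "\<forall>P P' Q Q'. P + P' = m \<longrightarrow> Q + Q' = m \<longrightarrow> dE (int P - int Q') (int P - int Q) m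
      = coeff_sign Q' m * kpair P' P (int Q - int Q' + 1) * kpair Q Q' (int P - int P' + 1)"
    and "P + P' = m" "Q + Q' = m"
  shows "dN (int P - int Q') (int P - int Q) m
      = coeff_sign Q' m * kpair P' P (int Q - int Q' - 1) * kpair Q Q' (int P - int P' + 1)" (is ?N)
    "dW (int P - int Q') (int P - int Q) m
      = coeff_sign Q' m * kpair P' P (int Q - int Q' - 1) * kpair Q Q' (int P - int P' - 1)" (is ?W)
    "dS (int P - int Q') (int P - int Q) m
      = - coeff_sign Q' m * kpair P' P (int Q - int Q' + 1) * kpair Q Q' (int P - int P' - 1)" (is ?S)
proof -
  have dual: "kpair P' P (int Q - int Q' - 1) = (- 1) ^ (P + Q) * \<i> * kpair P P' (int Q' - int Q + 1)"
     "kpair P' P (int Q - int Q' + 1) = - ((- 1) ^ (P + Q) * \<i> * kpair P P' (int Q' - int Q - 1))"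
    if "P + P' = m" "Q + Q' = m" for P P' Q Q'
    using kpair_dual[of "int Q - int Q' - 1" Q P P'] kpair_dual[of "int Q - int Q' + 1" "Suc Q" P P'] that
    by (auto simp: algebra_simps)
  have sgn: "coeff_sign P' m = (- 1) ^ (P + Q) * coeff_sign Q' m" if "P + P' = m" "Q + Q' = m" for P P' Q Q'
  proof -
    have "even P' \<longleftrightarrow> even (P + Q + Q')" using that by presburger
    then show ?thesis by (auto simp: coeff_sign_def power_add uminus_power_if)
  qed
  \<comment> \<open>The turn from \<open>(j, k)\<close> to \<open>(k, - j)\<close> replaces
    \<open>(P, P', Q, Q')\<close> by \<open>(Q', Q, P, P')\<close>.\<close>
  have rot: "int Q' - int P' = int P - int Q" "int Q' - int P = - (int P - int Q')"
    if "P + P' = m" "Q + Q' = m" for P P' Q Q' using that by auto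
  have N: "dN (int P - int Q') (int P - int Q) m
      = coeff_sign Q' m * kpair P' P (int Q - int Q' - 1) * kpair Q Q' (int P - int P' + 1)"
    if "P + P' = m" "Q + Q' = m" for P P' Q Q'
    unfolding increment_rot(1)[of "int P - int Q'"] dual[OF that]
    using E[rule_format, of Q' Q P P', unfolded rot[OF that]] that sgn[OF that] by simp
  have W: "dW (int P - int Q') (int P - int Q) m
      = coeff_sign Q' m * kpair P' P (int Q - int Q' - 1) * kpair Q Q' (int P - int P' - 1)"
    if "P + P' = m" "Q + Q' = m" for P P' Q Q'
    unfolding increment_rot(2)[of "int P - int Q'"] dual[OF that]
    using N[of Q' Q P P', unfolded rot[OF that]] that sgn[OF that] by simp
  show ?N ?W by (rule N W; fact)+
  show ?S
    unfolding increment_rot(3)[of "int P - int Q'"] dual[OF assms(2,3)]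
    using W[of Q' Q P P', unfolded rot[OF assms(2,3)]] assms(2,3) sgn[OF assms(2,3)] by simp
qed

text \<open>In the interior the recurrence factors as
  \<open>a b + c b - a d - c d = (a + c) (b - d)\<close>, one Pascal step in each factor. The
  vanishing of \<open>P'\<close> or \<open>Q'\<close> marks the north-eastern or south-eastern side,
  where one factor is the top coefficient 1 and only the other one moves.\<close>

lemma dE_eq:
  "P + P' = m \<Longrightarrow> Q + Q' = m \<Longrightarrow> dE (int P - int Q') (int P - int Q) m
      = coeff_sign Q' m * kpair P' P (int Q - int Q' + 1) * kpair Q Q' (int P - int P' + 1)"
proof (induction m arbitrary: P P' Q Q')
  case 0
  then show ?case by (simp add: dE_def coeff_sign_def kpair_top Let_def numeral_2_eq_2)
next
  case (Suc m)
  have "\<forall>P P' Q Q'. P + P' = m \<longrightarrow> Q + Q' = m \<longrightarrow> dE (int P - int Q') (int P - int Q) m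
      = coeff_sign Q' m * kpair P' P (int Q - int Q' + 1) * kpair Q Q' (int P - int P' + 1)"
    using Suc.IH by blast
  note others = increments_of_dE[OF this]
  show ?case
  proof (cases P')
    case [simp]: 0
    show ?thesis
    proof (cases Q')
      case [simp]: 0
      have "P = Suc m" "Q = Suc m" using Suc.prems by auto
      then show ?thesis using Suc.IH[of m 0 m 0] dE_rec_corner[of m, unfolded add.commute[of "int m"]]
        by (simp only:) (simp add: coeff_sign_def kpair_top)
    next
      case [simp]: (Suc q')
      obtain p where [simp]: "P = Suc p" using Suc.prems by (cases P) auto
      have eq: "p + 0 = m" "Q + q' = m" using Suc.prems by auto
      have rec: "dE (int P - int Q') (int P - int Q) (Suc m)
          = (dE (int p - int q') (int p - int Q) m - dN (int p - int q') (int p - int Q) m) / 2"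
        using dE_rec_NE[of "int P - int Q'" "int P - int Q" m] eq by (simp add: algebra_simps)
      have A: "kpair P' P (int Q - int Q' + 1) = kpair 0 p (int Q - int q' - 1) - kpair 0 p (int Q - int q' + 1)"
        by (simp add: kpair_Suc)
      have B: "kpair Q Q' (int P - int P' + 1) = 1" "kpair Q q' (int p - int 0 + 1) = 1"
        using eq by (auto intro!: kpair_top)
      show ?thesis unfolding rec Suc.IH[OF eq] others(1)[OF eq] A B
        by (simp add: coeff_sign_def field_simps)
    qed
  next
    case [simp]: (Suc p')
    show ?thesis
    proof (cases Q')
      case [simp]: 0
      obtain q where [simp]: "Q = Suc q" using Suc.prems by (cases Q) auto
      have eq: "P + p' = m" "q + 0 = m" using Suc.prems by auto
      have rec: "dE (int P - int Q') (int P - int Q) (Suc m)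
          = (dE (int P - int 0) (int P - int q) m - dS (int P - int 0) (int P - int q) m) / 2"
        using dE_rec_SE[of "int P - int Q'" "int P - int Q" m] eq by (simp add: algebra_simps)
      have B: "kpair Q Q' (int P - int P' + 1) = kpair q 0 (int P - int p' - 1) + kpair q 0 (int P - int p' + 1)"
        by (simp add: kpair_Suc)
      have A: "kpair P' P (int Q - int Q' + 1) = 1" "kpair p' P (int q - int 0 + 1) = 1"
        using eq by (auto intro!: kpair_top)
      show ?thesis unfolding rec Suc.IH[OF eq] others(3)[OF eq] A B
        by (simp add: coeff_sign_def field_simps)
    next
      case [simp]: (Suc q')
      have eq: "P + p' = m" "Q + q' = m" using Suc.prems by auto
      have rec: "dE (int P - int Q') (int P - int Q) (Suc m)
        = (dE (int P - int q') (int P - int Q) m + dN (int P - int q') (int P - int Q) m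
         + dS (int P - int q') (int P - int Q) m - dW (int P - int q') (int P - int Q) m) / 2"
        using dE_rec_inner[of "int P - int Q'" "int P - int Q" m] eq by (simp add: algebra_simps)
      have A: "kpair P' P (int Q - int Q' + 1) = kpair p' P (int Q - int q' - 1) + kpair p' P (int Q - int q' + 1)"
        by (simp add: kpair_Suc)
      have B: "kpair Q Q' (int P - int P' + 1) = kpair Q q' (int P - int p' - 1) - kpair Q q' (int P - int p' + 1)"
        by (simp add: kpair_Suc)
      show ?thesis unfolding rec Suc.IH[OF eq] others[OF eq] A B
        by (simp add: coeff_sign_def field_simps)
    qed
  qed
qed

lemma increment_eqs:
  assumes "P + P' = m" "Q + Q' = m"
  shows "dE (int P - int Q') (int P - int Q) m
      = coeff_sign Q' m * kpair P' P (int Q - int Q' + 1) * kpair Q Q' (int P - int P' + 1)"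
    "dN (int P - int Q') (int P - int Q) m
      = coeff_sign Q' m * kpair P' P (int Q - int Q' - 1) * kpair Q Q' (int P - int P' + 1)"
    "dW (int P - int Q') (int P - int Q) m
      = coeff_sign Q' m * kpair P' P (int Q - int Q' - 1) * kpair Q Q' (int P - int P' - 1)"
    "dS (int P - int Q') (int P - int Q) m
      = - coeff_sign Q' m * kpair P' P (int Q - int Q' + 1) * kpair Q Q' (int P - int P' - 1)"
proof -
  have "\<forall>P P' Q Q'. P + P' = m \<longrightarrow> Q + Q' = m \<longrightarrow> dE (int P - int Q') (int P - int Q) m
      = coeff_sign Q' m * kpair P' P (int Q - int Q' + 1) * kpair Q Q' (int P - int P' + 1)"
    using dE_eq by blast
  note N = increments_of_dE[OF this assms]
  show "dE (int P - int Q') (int P - int Q) m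
      = coeff_sign Q' m * kpair P' P (int Q - int Q' + 1) * kpair Q Q' (int P - int P' + 1)"
    by (rule dE_eq[OF assms])
  show "dN (int P - int Q') (int P - int Q) m
      = coeff_sign Q' m * kpair P' P (int Q - int Q' - 1) * kpair Q Q' (int P - int P' + 1)"
    "dW (int P - int Q') (int P - int Q) m
      = coeff_sign Q' m * kpair P' P (int Q - int Q' - 1) * kpair Q Q' (int P - int P' - 1)"
    "dS (int P - int Q') (int P - int Q) m
      = - coeff_sign Q' m * kpair P' P (int Q - int Q' + 1) * kpair Q Q' (int P - int P' - 1)"
    by (rule N)+
qed

section \<open>Angles in an octahedron\<close>

text \<open>A real Moebius map of positive determinant preserves the upper half plane:
  \<open>Im (x * cnj y)\<close> is the determinant times \<open>Im r\<close>, hence at least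
  \<open>e\<close>. Since \<open>|x|\<close> and \<open>|y|\<close> are at most
  \<open>4 / e\<close>, the sine of the argument is at least \<open>e^3 / 16\<close>. As
  \<open>sin t \<le> t\<close> at the argument and at its supplement, both are at least as large;
  halving makes the bounds strict.\<close>

lemma moebius_Arg:
  fixes \<alpha> \<beta> \<gamma> \<delta> e :: real and r s X Y :: complex
  assumes r: "r \<in> uhp_compact e" and e: "0 < e" "e \<le> 1"
    and X: "X = s * (\<alpha> * r + \<beta>)" and Y: "Y = s * (\<gamma> * r + \<delta>)" and s: "s \<noteq> 0"
    and coeffs: "\<bar>\<alpha>\<bar> \<le> 2" "\<bar>\<beta>\<bar> \<le> 2" "\<bar>\<gamma>\<bar> \<le> 2" "\<bar>\<delta>\<bar> \<le> 2" and det: "1 \<le> \<alpha> * \<delta> - \<beta> * \<gamma>"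
  shows "Arg (X / Y) \<in> {e ^ 3 / 32<..<pi - e ^ 3 / 32}"
proof -
  define x y where "x = \<alpha> * r + \<beta>" and "y = \<gamma> * r + \<delta>"
  define z where "z = x / y"
  have XY: "X / Y = z" using s by (simp add: X Y x_def y_def z_def)
  have r1: "e \<le> Im r" "e * cmod r \<le> 1" using r by (auto simp: uhp_compact_def)
  have bd: "e * cmod (a * r + b) \<le> 4" if "\<bar>a\<bar> \<le> 2" "\<bar>b\<bar> \<le> 2" for a b :: real
  proof -
    have "cmod (a * r + b) \<le> \<bar>a\<bar> * cmod r + \<bar>b\<bar>"
      by (rule order_trans[OF norm_triangle_ineq]) (simp add: norm_mult)
    also have "\<dots> \<le> 2 * cmod r + 2" using that by (intro add_mono mult_right_mono) auto
    finally have "e * cmod (a * r + b) \<le> e * (2 * cmod r + 2)" using e by (intro mult_left_mono) auto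
    also have "\<dots> \<le> 4" using r1 e by (simp add: algebra_simps)
    finally show ?thesis .
  qed
  have im: "Im (x * cnj y) = (\<alpha> * \<delta> - \<beta> * \<gamma>) * Im r"
    by (simp add: x_def y_def algebra_simps)
  have "1 * Im r \<le> (\<alpha> * \<delta> - \<beta> * \<gamma>) * Im r" using det r1 e by (intro mult_right_mono) auto
  then have ime: "e \<le> Im (x * cnj y)" using im r1 by linarith
  then have y0: "y \<noteq> 0" and x0: "x \<noteq> 0" using e by auto
  have "(e * cmod x) * (e * cmod y) \<le> 4 * 4"
    unfolding x_def y_def using e by (intro mult_mono bd coeffs) auto
  then have "e ^ 2 * (cmod x * cmod y) \<le> 16" by (simp add: power2_eq_square algebra_simps)
  then have "e * (e ^ 2 * (cmod x * cmod y)) \<le> e * 16" using e by (intro mult_left_mono) auto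
  then have "e ^ 3 / 16 * (cmod x * cmod y) \<le> e" by (simp add: power3_eq_cube power2_eq_square)
  then have 1: "e ^ 3 / 16 * (cmod x * cmod y) \<le> Im (x * cnj y)" using ime by linarith
  have "z = x * cnj y / of_real ((cmod y)\<^sup>2)"
    unfolding z_def by (subst complex_div_cnj) simp
  then have imz: "Im z = Im (x * cnj y) / (cmod y)\<^sup>2" by (simp only: Im_divide_of_real)
  have cz: "cmod z = (cmod x * cmod y) / (cmod y)\<^sup>2"
    by (simp add: z_def norm_divide power2_eq_square)
  have key: "e ^ 3 / 16 * cmod z \<le> Im z"
    using divide_right_mono[OF 1, of "(cmod y)\<^sup>2"] unfolding imz cz by simp
  have z0: "0 < cmod z" using x0 y0 by (simp add: z_def)
  have e3: "0 < e ^ 3" using e by simp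
  have imz0: "0 < Im z" using key z0 e3 by (smt (verit) mult_pos_pos divide_pos_pos)
  then have A: "0 < Arg z" "Arg z < pi" using Arg_lt_pi[of z] by auto
  have "Im z = cmod z * sin (Arg z)" by (metis Im_rcis Arg_eq rcis_cmod_Arg)
  then have "cmod z * (e ^ 3 / 16) \<le> cmod z * sin (Arg z)" using key by (simp add: mult.commute)
  then have sin: "e ^ 3 / 16 \<le> sin (Arg z)" using z0 mult_le_cancel_left_pos by blast
  have "sin (Arg z) \<le> Arg z" using A by (intro sin_x_le_x) auto
  moreover have "sin (pi - Arg z) \<le> pi - Arg z" using A by (intro sin_x_le_x) auto
  ultimately have "e ^ 3 / 16 \<le> Arg z" "e ^ 3 / 16 \<le> pi - Arg z" using sin by auto
  then show ?thesis using e3 unfolding XY greaterThanLessThan_iff by linarith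
qed

text \<open>A triple \<open>(v, x, y)\<close> stands for the angle at \<open>v\<close> from \<open>x\<close> counterclockwise to \<open>y\<close>. Every face
  angle of the t-embedding occurs in the octahedron around the face itself or one of its
  neighbours, since the levels of neighbouring columns differ by one.\<close>

definition octahedron_corners :: "int \<Rightarrow> int \<Rightarrow> nat \<Rightarrow> (complex \<times> complex \<times> complex) set" where
  "octahedron_corners j k m =
    (let B = aztec j k (m + 1); T = aztec j k (m + 3); E = aztec (j + 1) k (m + 2);
         N = aztec j (k + 1) (m + 2); W = aztec (j - 1) k (m + 2); S = aztec j (k - 1) (m + 2)
     in {(B, E, N), (B, N, W), (B, W, S), (B, S, E), (T, E, N), (T, N, W), (T, W, S), (T, S, E),
         (E, N, B), (N, B, E), (S, B, W), (W, S, B), (E, N, T), (N, T, E), (S, T, W), (W, S, T)})"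

text \<open>The product formula describes the octahedron up to similarity by two ratios:
  \<open>\<rho> = c / a\<close> and \<open>\<sigma> = e / b\<close>, the latter written
  \<open>d / b\<close> in the overview. The top vertex comes from the wave equation.\<close>

lemma octahedron_increments:
  assumes d: "0 < d" "d \<le> 1" and par: "even (j + k + int m)"
    and bulk: "2 * ((real_of_int j)\<^sup>2 + (real_of_int k)\<^sup>2) \<le> (1 - d) * (real m)\<^sup>2"
  obtains t \<rho> \<sigma> where "t \<noteq> 0" "\<rho> \<in> uhp_compact (d\<^sup>2 / 24)" "\<sigma> \<in> uhp_compact (d\<^sup>2 / 24)"
    "aztec (j + 1) k (m + 2) = aztec j k (m + 1) + t"
    "aztec j (k + 1) (m + 2) = aztec j k (m + 1) + \<rho> * t"
    "aztec (j - 1) k (m + 2) = aztec j k (m + 1) + \<rho> * \<sigma> * t"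
    "aztec j (k - 1) (m + 2) = aztec j k (m + 1) - \<sigma> * t"
    "aztec j k (m + 3) = aztec j k (m + 1) + (1 + \<rho> + \<rho> * \<sigma> - \<sigma>) / 2 * t"
proof -
  have "(real_of_int (\<bar>j\<bar> + \<bar>k\<bar>))\<^sup>2 \<le> 2 * ((real_of_int j)\<^sup>2 + (real_of_int k)\<^sup>2)"
    using zero_le_power2[of "\<bar>real_of_int j\<bar> - \<bar>real_of_int k\<bar>"] by (simp add: power2_eq_square algebra_simps)
  also have "\<dots> \<le> 1 * (real m)\<^sup>2" using bulk d mult_right_mono[of "1 - d" 1 "(real m)\<^sup>2"] by simp
  finally have "\<bar>real_of_int (\<bar>j\<bar> + \<bar>k\<bar>)\<bar> \<le> real m" by (simp add: abs_le_square_iff[symmetric])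
  then have jk: "\<bar>j\<bar> + \<bar>k\<bar> \<le> int m" by linarith
  define P P' Q Q' where "P = nat ((int m + j + k) div 2)" and "P' = nat ((int m - j - k) div 2)"
    and "Q = nat ((int m + j - k) div 2)" and "Q' = nat ((int m - j + k) div 2)"
  have i: "2 * int P = int m + j + k" "2 * int P' = int m - j - k"
    "2 * int Q = int m + j - k" "2 * int Q' = int m - j + k"
  proof -
    have half: "2 * int (nat (x div 2)) = x" if "0 \<le> x" "even x" for x using that by auto
    show "2 * int P = int m + j + k" "2 * int P' = int m - j - k"
      "2 * int Q = int m + j - k" "2 * int Q' = int m - j + k"
      unfolding P_def P'_def Q_def Q'_def by (rule half; use jk par in auto)+
  qed
  have sum: "P + P' = m" "Q + Q' = m" using i by linarith+
  have jk': "int P - int Q' = j" "int P - int Q = k" using i by linarith+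
  define u v where "u = int Q - int Q'" and "v = int P - int P'"
  have uv: "u = j - k" "v = j + k" using i unfolding u_def v_def by linarith+
  define a c b e where "a = kpair P' P (u + 1)" and "c = kpair P' P (u - 1)"
    and "b = kpair Q Q' (v + 1)" and "e = kpair Q Q' (v - 1)"
  have E: "dE j k m = coeff_sign Q' m * a * b"
    and NWS: "dN j k m = coeff_sign Q' m * c * b" "dW j k m = coeff_sign Q' m * c * e"
     "dS j k m = - coeff_sign Q' m * a * e"
    using increment_eqs[OF sum] unfolding jk' a_def b_def c_def e_def u_def v_def by blast+
  have sq: "(real_of_int v)\<^sup>2 + (real_of_int u)\<^sup>2 \<le> (1 - d) * (real m)\<^sup>2"
    using bulk by (simp add: uv power2_eq_square algebra_simps)
  \<comment> \<open>Up to sign, the index difference of each Krawtchouk factor is the argument of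
    the other. Both bulk conditions therefore read
    \<open>u^2 + v^2 = 2 (j^2 + k^2) \<le> (1 - d) m^2\<close>.\<close>
  have "real P' - real P = - real_of_int v" "real Q - real Q' = real_of_int u"
    by (simp_all add: u_def v_def)
  then have bulks: "(real P' - real P)\<^sup>2 + (real_of_int u)\<^sup>2 \<le> (1 - d) * (real (P' + P))\<^sup>2"
    "(real Q - real Q')\<^sup>2 + (real_of_int v)\<^sup>2 \<le> (1 - d) * (real (Q + Q'))\<^sup>2"
    using sq by (simp_all only: add.commute[of P' P] sum) simp_all
  have pars: "even (u + int (P' + P))" "even (v + int (Q + Q'))"
    using par unfolding add.commute[of P' P] sum uv by auto
  note A = kpair_ratio[OF d pars(1) bulks(1), folded a_def c_def]
  note B = kpair_ratio[OF d pars(2) bulks(2), folded b_def e_def]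
  let ?t = "coeff_sign Q' m * a * b"
  have N: "dN j k m = c / a * ?t" and W: "dW j k m = c / a * (e / b) * ?t" and S: "dS j k m = - (e / b * ?t)"
    using A(1) B(1) by (simp_all add: NWS)
  have T: "aztec j k (m + 3) = (aztec (j + 1) k (m + 2) + aztec (j - 1) k (m + 2)
    + aztec j (k + 1) (m + 2) + aztec j (k - 1) (m + 2)) / 2 - aztec j k (m + 1)"
  proof -
    have "(j, k) \<notin> {(int (m + 1) + 1, 0), (0, int (m + 1) + 1), (- int (m + 1) - 1, 0), (0, - int (m + 1) - 1)}"
      using jk by auto
    from aztec_rec[OF _ this] jk show ?thesis by (simp add: numeral_3_eq_3 del: aztec.simps)
  qed
  show thesis
  proof (rule that[OF _ A(2) B(2)])
    show "?t \<noteq> 0" using A(1) B(1) by (simp add: coeff_sign_def)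
    show 1: "aztec (j + 1) k (m + 2) = aztec j k (m + 1) + ?t"
      using E by (simp add: dE_def algebra_simps del: aztec.simps)
    show 2: "aztec j (k + 1) (m + 2) = aztec j k (m + 1) + c / a * ?t"
      using N by (simp add: dN_def algebra_simps del: aztec.simps)
    show 3: "aztec (j - 1) k (m + 2) = aztec j k (m + 1) + c / a * (e / b) * ?t"
      using W by (simp add: dW_def algebra_simps del: aztec.simps)
    show 4: "aztec j (k - 1) (m + 2) = aztec j k (m + 1) - e / b * ?t"
      using S by (simp add: dS_def algebra_simps del: aztec.simps)
    show "aztec j k (m + 3) = aztec j k (m + 1) + (1 + c / a + c / a * (e / b) - e / b) / 2 * ?t"
      unfolding T 1 2 3 4 by algebra
  qed
qed

text \<open>The edges at the top factor as well: east, north, west and south are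
  \<open>t / 2\<close> times \<open>(1 - \<rho>) (1 + \<sigma>)\<close>,
  \<open>(1 - \<rho>) (\<sigma> - 1)\<close>, \<open>(1 + \<rho>) (\<sigma> - 1)\<close> and
  \<open>- (1 + \<rho>) (1 + \<sigma>)\<close>. So the two sides of each angle share a factor and
  their quotient depends on one ratio only.\<close>

lemma octahedron_angles:
  assumes d: "0 < d" "d \<le> 1" and par: "even (j + k + int m)"
    and bulk: "2 * ((real_of_int j)\<^sup>2 + (real_of_int k)\<^sup>2) \<le> (1 - d) * (real m)\<^sup>2"
    and mem: "(v, x, y) \<in> octahedron_corners j k m"
  shows "Arg ((y - v) / (x - v)) \<in> {(d\<^sup>2 / 24) ^ 3 / 32<..<pi - (d\<^sup>2 / 24) ^ 3 / 32}"
proof -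
  obtain t \<rho> \<sigma> where t: "t \<noteq> 0" and \<rho>: "\<rho> \<in> uhp_compact (d\<^sup>2 / 24)" and \<sigma>: "\<sigma> \<in> uhp_compact (d\<^sup>2 / 24)"
    and eqs: "aztec (j + 1) k (m + 2) = aztec j k (m + 1) + t"
    "aztec j (k + 1) (m + 2) = aztec j k (m + 1) + \<rho> * t"
    "aztec (j - 1) k (m + 2) = aztec j k (m + 1) + \<rho> * \<sigma> * t"
    "aztec j (k - 1) (m + 2) = aztec j k (m + 1) - \<sigma> * t"
    "aztec j k (m + 3) = aztec j k (m + 1) + (1 + \<rho> + \<rho> * \<sigma> - \<sigma>) / 2 * t"
    using octahedron_increments[OF d par bulk] by metis
  have d24: "0 < d\<^sup>2 / 24" "d\<^sup>2 / 24 \<le> 1" using d power_le_one[of d 2] by auto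
  \<comment> \<open>The ratios are not real, so no common factor below vanishes.\<close>
  have "Im \<rho> > 0" "Im \<sigma> > 0"
    using \<rho> \<sigma> d24(1) unfolding uhp_compact_def mem_Collect_eq by linarith+
  then have nz: "\<rho> \<noteq> 0" "\<sigma> \<noteq> 0" "\<rho> \<noteq> 1" "1 \<noteq> \<rho>" "1 + \<rho> \<noteq> 0" "1 + \<sigma> \<noteq> 0" "\<sigma> \<noteq> 1"
    by (auto simp: complex_eq_iff)
  define o' where "o' = aztec j k (m + 1)"
  note R = moebius_Arg[OF \<rho> d24] and S = moebius_Arg[OF \<sigma> d24]
  \<comment> \<open>For each corner, \<open>s\<close> is the common factor of the two sides and
    \<open>\<alpha>, \<beta>, \<gamma>, \<delta>\<close> is the Moebius matrix in the remaining
    ratio.\<close>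
  show ?thesis
    using mem unfolding octahedron_corners_def Let_def eqs o'_def[symmetric] insert_iff prod.inject
    apply (elim disjE conjE emptyE; hypsubst)
    subgoal by (rule R[where s = "t" and \<alpha> = 1 and \<beta> = 0 and \<gamma> = 0 and \<delta> = 1];
      (simp add: t nz; fail | simp add: field_simps; fail))
    subgoal by (rule S[where s = "\<rho> * t" and \<alpha> = 1 and \<beta> = 0 and \<gamma> = 0 and \<delta> = 1];
      (simp add: t nz; fail | simp add: field_simps; fail))
    subgoal by (rule R[where s = "\<sigma> * t" and \<alpha> = 0 and \<beta> = "- 1" and \<gamma> = 1 and \<delta> = 0];
      (simp add: t nz; fail | simp add: field_simps; fail))
    subgoal by (rule S[where s = "t" and \<alpha> = 0 and \<beta> = 1 and \<gamma> = "- 1" and \<delta> = 0];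
      (simp add: t nz; fail | simp add: field_simps; fail))
    subgoal by (rule S[where s = "(1 - \<rho>) * t / 2" and \<alpha> = 1 and \<beta> = "- 1" and \<gamma> = 1 and \<delta> = 1];
      (simp add: t nz; fail | simp add: field_simps; fail))
    subgoal by (rule R[where s = "(\<sigma> - 1) * t / 2" and \<alpha> = 1 and \<beta> = 1 and \<gamma> = "- 1" and \<delta> = 1];
      (simp add: t nz; fail | simp add: field_simps; fail))
    subgoal by (rule S[where s = "(1 + \<rho>) * t / 2" and \<alpha> = "- 1" and \<beta> = "- 1" and \<gamma> = 1 and \<delta> = "- 1"];
      (simp add: t nz; fail | simp add: field_simps; fail))
    subgoal by (rule R[where s = "(1 + \<sigma>) * t / 2" and \<alpha> = "- 1" and \<beta> = 1 and \<gamma> = "- 1" and \<delta> = "- 1"];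
      (simp add: t nz; fail | simp add: field_simps; fail))
    subgoal by (rule R[where s = "t" and \<alpha> = 0 and \<beta> = "- 1" and \<gamma> = 1 and \<delta> = "- 1"];
      (simp add: t nz; fail | simp add: field_simps; fail))
    subgoal by (rule R[where s = "t" and \<alpha> = "- 1" and \<beta> = 1 and \<gamma> = "- 1" and \<delta> = 0];
      (simp add: t nz; fail | simp add: field_simps; fail))
    subgoal by (rule R[where s = "\<sigma> * t" and \<alpha> = 1 and \<beta> = 1 and \<gamma> = 0 and \<delta> = 1];
      (simp add: t nz; fail | simp add: field_simps; fail))
    subgoal by (rule R[where s = "- (\<sigma> * t)" and \<alpha> = 1 and \<beta> = 0 and \<gamma> = 1 and \<delta> = 1];
      (simp add: t nz; fail | simp add: field_simps; fail))
    subgoal by (rule S[where s = "(\<rho> - 1) * t / 2" and \<alpha> = 1 and \<beta> = 1 and \<gamma> = 0 and \<delta> = 2];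
      (simp add: t nz; fail | simp add: field_simps; fail))
    subgoal by (rule S[where s = "(1 - \<rho>) * t / 2" and \<alpha> = 0 and \<beta> = 2 and \<gamma> = "- 1" and \<delta> = 1];
      (simp add: t nz; fail | simp add: field_simps; fail))
    subgoal by (rule S[where s = "(1 + \<rho>) * t / 2" and \<alpha> = 2 and \<beta> = 0 and \<gamma> = 1 and \<delta> = 1];
      (simp add: t nz; fail | simp add: field_simps; fail))
    subgoal by (rule S[where s = "(1 + \<rho>) * t / 2" and \<alpha> = "- 1" and \<beta> = 1 and \<gamma> = "- 2" and \<delta> = 0];
      (simp add: t nz; fail | simp add: field_simps; fail))
    done
qed

section \<open>The path in the liquid region\<close>

lemma fbar_lipschitz:
  assumes f: "admissible f"
  shows "\<bar>fbar f x - fbar f y\<bar> \<le> \<bar>x - y\<bar>"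
proof -
  obtain xs where xs: "is_smallest_fixpoint f xs"
    and d: "\<And>y. y \<in> {- 1..xs} \<Longrightarrow> f differentiable (at y) \<and> \<bar>deriv f y\<bar> \<le> 1" and f1: "f (- 1) = 1"
    using f by (auto simp: admissible_def)
  note eq = xstar_eq[OF xs]
  from xs have xs1: "- 1 < xs" "f xs = xs" by (auto simp: is_smallest_fixpoint_def)
  have lip: "\<bar>f b - f a\<bar> \<le> b - a" if "- 1 \<le> a" "a \<le> b" "b \<le> xs" for a b
  proof (cases "a = b")
    case False
    with that have "a < b" by simp
    moreover have "(f has_real_derivative deriv f z) (at z)" if "a \<le> z" "z \<le> b" for z
      using d[of z] that \<open>- 1 \<le> a\<close> \<open>b \<le> xs\<close> by (simp add: DERIV_deriv_iff_real_differentiable)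
    ultimately obtain z where z: "a < z" "z < b" "f b - f a = (b - a) * deriv f z"
      using MVT2[of a b f "deriv f"] by blast
    have "\<bar>f b - f a\<bar> = (b - a) * \<bar>deriv f z\<bar>" using z by (simp add: abs_mult)
    also have "\<dots> \<le> (b - a) * 1" using d[of z] z that by (intro mult_left_mono) auto
    finally show ?thesis by simp
  qed simp
  define cl where "cl x = max (- 1) (min x xs)" for x
  \<comment> \<open>Clamping separates the part governed by the mean value theorem from the outer
    parts of slope 1 and -1; the increments of \<open>cl x\<close> and of \<open>x - cl x\<close>
    add up to that of \<open>x\<close>.\<close>
  have fb: "fbar f x = f (cl x) + \<bar>x - cl x\<bar>" for x
    using xs1 f1 by (auto simp: fbar_def eq cl_def)
  have main: "\<bar>fbar f b - fbar f a\<bar> \<le> b - a" if "a \<le> b" for a b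
  proof -
    have "\<bar>f (cl b) - f (cl a)\<bar> \<le> cl b - cl a"
      using xs1 that by (intro lip) (auto simp: cl_def)
    moreover have "\<bar>\<bar>b - cl b\<bar> - \<bar>a - cl a\<bar>\<bar> \<le> (b - cl b) - (a - cl a)"
      using xs1 that by (auto simp: cl_def max_def min_def)
    ultimately show ?thesis by (simp add: fb)
  qed
  show ?thesis using main[of x y] main[of y x] by (cases "x \<le> y") auto
qed

text \<open>Maximality allows comparison with an explicit competitor. Of the loss 3, one unit is the
  \<open>+ 1\<close> in the constraint, and the floor with the parity correction costs less than
  two.\<close>

lemma max_path_ge:
  assumes f: "admissible f"
  shows "(real n + 1) * fbar f (of_int c / (real n + 1)) - 3 \<le> max_path f n c"
proof -
  define m where "m = real n + 1"
  have m: "m > 0" by (simp add: m_def)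
  define g where "g y = m * fbar f (y / m) - 1" for y
  have g: "\<bar>g x - g y\<bar> \<le> \<bar>x - y\<bar>" for x y
  proof -
    have "\<bar>g x - g y\<bar> = m * \<bar>fbar f (x / m) - fbar f (y / m)\<bar>"
      using m by (simp add: g_def right_diff_distrib[symmetric] abs_mult)
    also have "\<dots> \<le> m * \<bar>x / m - y / m\<bar>"
      using m by (intro mult_left_mono fbar_lipschitz f) auto
    also have "\<dots> = \<bar>x - y\<bar>" using m by (simp add: diff_divide_distrib[symmetric])
    finally show ?thesis .
  qed
  \<comment> \<open>The largest integer of the right parity below the 1-Lipschitz function \<open>g\<close> is a path.\<close>
  define G :: "int \<Rightarrow> int" where
    "G c = \<lfloor>g (of_int c)\<rfloor> - (if odd (\<lfloor>g (of_int c)\<rfloor> + c) then 0 else 1)" for c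
  have par: "odd (G c + c)" for c by (auto simp: G_def)
  have Gg: "of_int (G c) \<le> g (of_int c)" "g (of_int c) < of_int (G c) + 2" for c
    by (auto simp: G_def) linarith+
  have step: "G (c + 1) - G c = 1 \<or> G (c + 1) - G c = - 1" for c
  proof -
    have "\<bar>g (of_int (c + 1)) - g (of_int c)\<bar> \<le> 1" using g[of "of_int (c + 1)" "of_int c"] by simp
    then have "of_int (G (c + 1)) < real_of_int (G c + 3)" "real_of_int (G c) < of_int (G (c + 1) + 3)"
      using Gg[of c] Gg[of "c + 1"] by simp_all
    then have "G (c + 1) < G c + 3" "G c < G (c + 1) + 3" by linarith+
    moreover have "odd (G (c + 1) - G c)" using par[of c] par[of "c + 1"] by simp
    ultimately show ?thesis by presburger
  qed
  have "path_below f n G"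
    unfolding path_below_def m_def[symmetric]
  proof (intro conjI allI)
    show "up_down_path G" using step par by (simp add: up_down_path_def)
    fix x
    define y k t where "y = m * x" and "k = \<lfloor>y\<rfloor>" and "t = frac y"
    have t: "0 \<le> t" "t < 1" "y = of_int k + t" unfolding t_def k_def by (simp_all add: frac_lt_1) (simp add: frac_def)
    have "lin_interp G y = G k + t * (G (k + 1) - G k)"
      by (simp add: lin_interp_def k_def t_def algebra_simps)
    \<comment> \<open>A rising step is compared with \<open>g\<close> at its right end, a falling
      one at its left end; there the slope 1 or -1 of the path matches the Lipschitz bound.\<close>
    moreover have "g y \<ge> g (of_int k) - t" "g y \<ge> g (of_int (k + 1)) - (1 - t)"
      using g[of y "of_int k"] g[of y "of_int (k + 1)"] t by auto
    moreover have "real_of_int (G (k + 1)) - G k = 1 \<or> real_of_int (G (k + 1)) - G k = - 1"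
      using step[of k] by linarith
    ultimately have "lin_interp G y \<le> g y"
      using Gg(1)[of k] Gg(1)[of "k + 1"] by (elim disjE) simp_all
    then show "1 / m * (lin_interp G (m * x) + 1) \<le> fbar f x"
      using m by (simp add: y_def g_def field_simps)
  qed
  then have "G \<le> max_path f n" by (rule max_path_props(2)[OF f])
  then have "G c \<le> max_path f n c" by (simp add: le_fun_def)
  then have "real_of_int (G c) \<le> max_path f n c" by simp
  with Gg(2)[of c] show ?thesis by (simp add: g_def m_def)
qed

text \<open>The liquid inequality says \<open>sqrt 2 * norm p < f (x + y)\<close> at
  \<open>p = (x, y)\<close>, so by compactness the gap \<open>phi\<close> has a positive minimum on
  \<open>K\<close>. After scaling it grows linearly in \<open>n\<close> and absorbs all bounded
  errors, including the shift to neighbouring faces and the lower levels of the octahedra.\<close>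

lemma max_path_bulk:
  assumes f: "admissible f" and K: "compact K" "K \<subseteq> liquid_region f"
  obtains d N where "0 < d" "d \<le> 1" "0 < N"
    "\<And>n j k j' k' m. real n > N \<Longrightarrow> rescaled_point n (j, k) \<in> K \<Longrightarrow> \<bar>j' - j\<bar> \<le> 1 \<Longrightarrow> \<bar>k' - k\<bar> \<le> 1 \<Longrightarrow>
      max_path f (n + 1) (j + k) - 3 \<le> int m \<Longrightarrow>
      2 * ((real_of_int j')\<^sup>2 + (real_of_int k')\<^sup>2) \<le> (1 - d) * (real m)\<^sup>2"
    "\<And>n j k. real n > N \<Longrightarrow> rescaled_point n (j, k) \<in> K \<Longrightarrow> 3 \<le> max_path f (n + 1) (j + k)"
proof -
  define phi where "phi p = fbar f (fst p + snd p) - sqrt 2 * norm p" for p :: "real \<times> real"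
  have cont: "continuous_on UNIV (fbar f)"
    by (rule lipschitz_on_continuous_on[of 1], rule lipschitz_onI)
       (use fbar_lipschitz[OF f] in \<open>auto simp: dist_real_def\<close>)
  have phi_cont: "continuous_on K phi"
    unfolding phi_def by (intro continuous_intros continuous_on_compose2[OF cont]) auto
  have phi_pos: "0 < phi p" if p: "p \<in> K" for p
  proof -
    obtain x y where xy: "p = (x, y)" by (cases p)
    have l: "- 1 < x + y" "x + y < xstar f" "\<bar>x - y\<bar> < f (x + y)" "2 * (x\<^sup>2 + y\<^sup>2) < (f (x + y))\<^sup>2"
      using K(2) p xy by (auto simp: liquid_region_def)
    have "sqrt 2 * norm p = sqrt (2 * (x\<^sup>2 + y\<^sup>2))" unfolding xy norm_Pair real_sqrt_mult by simp
    also have "\<dots> < f (x + y)" using l(3,4) by (intro real_less_lsqrt) auto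
    finally show ?thesis using l by (simp add: phi_def xy fbar_def)
  qed
  obtain \<eta> where \<eta>: "0 < \<eta>" "\<And>p. p \<in> K \<Longrightarrow> \<eta> \<le> phi p"
  proof (cases "K = {}")
    case True
    then show ?thesis using that[of 1] by simp
  next
    case False
    then obtain p where "p \<in> K" "\<And>q. q \<in> K \<Longrightarrow> phi p \<le> phi q"
      using continuous_attains_inf[OF K(1) _ phi_cont] by blast
    then show ?thesis using that[of "phi p"] phi_pos by blast
  qed
  obtain B where B: "0 < B" "\<And>p. p \<in> K \<Longrightarrow> norm p \<le> B"
    using compact_imp_bounded[OF K(1)] bounded_pos by blast
  \<comment> \<open>\<open>X \<le> A (n + 1)\<close>, with \<open>X\<close> as below, makes
    \<open>\<theta>\<close> a bound for \<open>X / (X + (n + 1) \<eta> / 2)\<close>. Beyond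
    \<open>N\<close>, half of the gap \<open>(n + 1) \<eta>\<close> exceeds the accumulated additive
    errors.\<close>
  define A where "A = 2 * B + 3"
  define \<theta> where "\<theta> = A / (A + \<eta> / 2)"
  have A: "0 < A" using B by (simp add: A_def)
  have \<theta>: "0 < \<theta>" "\<theta> < 1" using A \<eta>(1) by (auto simp: \<theta>_def)
  define N where "N = (4 * B + 24) / \<eta>"
  have lower: "sqrt 2 * norm (real_of_int j, real_of_int k) + (real n + 1) * \<eta> - 2 * B - 3
      \<le> max_path f (n + 1) (j + k)"
    "norm (real_of_int j, real_of_int k) \<le> B * (real n + 1)"
    if p: "rescaled_point n (j, k) \<in> K" for n j k
  proof -
    define M where "M = real n + 1"
    have M: "0 < M" by (simp add: M_def)
    define c where "c = real_of_int (j + k)"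
    have rp: "rescaled_point n (j, k) = (1 / M) *\<^sub>R (real_of_int j, real_of_int k)"
      by (simp add: rescaled_point_def M_def)
    have norm_rp: "norm (rescaled_point n (j, k)) = norm (real_of_int j, real_of_int k) / M"
      unfolding rp norm_scaleR using M by simp
    show nB: "norm (real_of_int j, real_of_int k) \<le> B * (real n + 1)"
      using B(2)[OF p] M unfolding norm_rp M_def[symmetric] by (simp add: field_simps)
    have "\<eta> \<le> phi (rescaled_point n (j, k))" by (rule \<eta>(2)[OF p])
    also have "\<dots> = fbar f (c / M) - sqrt 2 * norm (real_of_int j, real_of_int k) / M"
      unfolding phi_def norm_rp by (simp add: rp c_def add_divide_distrib)
    finally have "M * \<eta> \<le> M * (fbar f (c / M) - sqrt 2 * norm (real_of_int j, real_of_int k) / M)"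
      using M by (intro mult_left_mono) auto
    then have 1: "sqrt 2 * norm (real_of_int j, real_of_int k) + M * \<eta> \<le> M * fbar f (c / M)"
      using M by (simp add: right_diff_distrib)
    have "\<bar>c\<bar> \<le> \<bar>real_of_int j\<bar> + \<bar>real_of_int k\<bar>" by (simp add: c_def)
    also have "\<dots> \<le> 2 * norm (real_of_int j, real_of_int k)"
      using norm_fst_le[of "real_of_int j" "real_of_int k"] norm_snd_le[of "real_of_int k" "real_of_int j"] by simp
    finally have cB: "\<bar>c\<bar> \<le> 2 * B * M" using nB by (simp add: M_def)
    \<comment> \<open>Faces are rescaled by \<open>n + 1\<close>, while the path of rank
      \<open>n + 1\<close> is scaled by \<open>n + 2\<close>; the Lipschitz bound shows that this
      mismatch costs at most \<open>2 * B\<close>.\<close>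
    have "\<bar>c / M - c / (M + 1)\<bar> = \<bar>c\<bar> / (M * (M + 1))"
    proof -
      have "c / M - c / (M + 1) = c / (M * (M + 1))" using M by (simp add: field_simps)
      then show ?thesis using M by simp
    qed
    also have "M * \<dots> = \<bar>c\<bar> / (M + 1)" using M by simp
    also have "\<dots> \<le> 2 * B"
    proof -
      have "\<bar>c\<bar> \<le> 2 * B * (M + 1)" using cB B by (simp add: algebra_simps)
      then show ?thesis using M by (simp add: pos_divide_le_eq)
    qed
    finally have 2: "M * \<bar>c / M - c / (M + 1)\<bar> \<le> 2 * B" .
    have "M * fbar f (c / M) - 2 * B \<le> M * fbar f (c / M) - M * \<bar>c / M - c / (M + 1)\<bar>" using 2 by simp
    also have "\<dots> = M * (fbar f (c / M) - \<bar>c / M - c / (M + 1)\<bar>)" by (simp add: right_diff_distrib)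
    also have "\<dots> \<le> M * fbar f (c / (M + 1))"
      using M fbar_lipschitz[OF f, of "c / M" "c / (M + 1)"] by (intro mult_left_mono) auto
    also have "\<dots> \<le> (M + 1) * fbar f (c / (M + 1))"
      using order_trans[OF abs_ge_zero abs_le_fbar[OF f, of "c / (M + 1)"]] by (simp add: distrib_right)
    also have "\<dots> \<le> max_path f (n + 1) (j + k) + 3"
      using max_path_ge[OF f, of "n + 1" "j + k"] by (simp add: M_def c_def add_ac)
    finally show "sqrt 2 * norm (real_of_int j, real_of_int k) + (real n + 1) * \<eta> - 2 * B - 3
      \<le> max_path f (n + 1) (j + k)" using 1 by (simp add: M_def)
  qed
  show thesis
  proof (rule that[of "1 - \<theta>\<^sup>2" N])
    show "0 < 1 - \<theta>\<^sup>2" "1 - \<theta>\<^sup>2 \<le> 1" using \<theta> by (auto simp: power_less_one_iff)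
    show "0 < N" using B \<eta> by (simp add: N_def)
    have big: "4 * B + 24 < (real n + 1) * \<eta>" if "real n > N" for n
    proof -
      have "4 * B + 24 < real n * \<eta>" using that \<eta>(1) by (simp add: N_def pos_divide_less_eq)
      then show ?thesis using \<eta>(1) by (simp add: distrib_right)
    qed
    fix n :: nat and j k :: int
    assume n: "real n > N" and p: "rescaled_point n (j, k) \<in> K"
    note low = lower[OF p] and big = big[OF n]
    have "0 \<le> sqrt 2 * norm (real_of_int j, real_of_int k)" by simp
    with low(1) big B have "3 \<le> real_of_int (max_path f (n + 1) (j + k))" by linarith
    then show "3 \<le> max_path f (n + 1) (j + k)" by linarith
    fix j' k' :: int and m :: nat
    assume j': "\<bar>j' - j\<bar> \<le> 1" "\<bar>k' - k\<bar> \<le> 1" and m: "max_path f (n + 1) (j + k) - 3 \<le> int m"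
    define q where "q = norm (real_of_int j', real_of_int k')"
    \<comment> \<open>Moving to a neighbour adds at most \<open>sqrt 2 * sqrt 2 = 2\<close>, covered
      by the 3.\<close>
    define X where "X = sqrt 2 * norm (real_of_int j, real_of_int k) + 3"
    have "q \<le> norm (real_of_int j, real_of_int k) + norm (real_of_int (j' - j), real_of_int (k' - k))"
      unfolding q_def using norm_triangle_ineq[of "(real_of_int j, real_of_int k)" "(real_of_int (j' - j), real_of_int (k' - k))"]
      by simp
    moreover have "norm (real_of_int (j' - j), real_of_int (k' - k)) \<le> sqrt 2"
    proof -
      have "(real_of_int (j' - j))\<^sup>2 \<le> 1" "(real_of_int (k' - k))\<^sup>2 \<le> 1"
        using j' by (simp_all only: abs_square_le_1)
      then show ?thesis by (simp add: norm_Pair)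
    qed
    ultimately have "sqrt 2 * q \<le> sqrt 2 * (norm (real_of_int j, real_of_int k) + sqrt 2)"
      by (intro mult_left_mono) auto
    then have qX: "sqrt 2 * q \<le> X" by (simp add: X_def distrib_left)
    have "sqrt 2 * norm (real_of_int j, real_of_int k) \<le> 2 * (B * (real n + 1))"
      using low(2) sqrt2_less_2 by (intro mult_mono) auto
    then have XA: "X \<le> A * (real n + 1)" by (simp add: X_def A_def algebra_simps)
    have mX: "X + (real n + 1) * \<eta> / 2 \<le> real m"
    proof -
      have "real_of_int (max_path f (n + 1) (j + k)) - 3 \<le> real m" using m by linarith
      then show ?thesis using low(1) big unfolding X_def by linarith
    qed
    have "X \<le> \<theta> * (X + (real n + 1) * \<eta> / 2)"
    proof -
      have "X * (\<eta> / 2) \<le> A * (real n + 1) * (\<eta> / 2)" using XA \<eta>(1) by (intro mult_right_mono) auto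
      then have "X * (A + \<eta> / 2) \<le> A * (X + (real n + 1) * \<eta> / 2)" by (simp add: algebra_simps)
      then show ?thesis using A \<eta>(1) by (simp add: \<theta>_def pos_le_divide_eq)
    qed
    also have "\<dots> \<le> \<theta> * real m" using mX \<theta> by (intro mult_left_mono) auto
    finally have "sqrt 2 * q \<le> \<theta> * real m" using qX by simp
    then have "(sqrt 2 * q)\<^sup>2 \<le> (\<theta> * real m)\<^sup>2" by (intro power_mono) (auto simp: q_def)
    then show "2 * ((real_of_int j')\<^sup>2 + (real_of_int k')\<^sup>2) \<le> (1 - (1 - \<theta>\<^sup>2)) * (real m)\<^sup>2"
      by (simp add: q_def norm_Pair power_mult_distrib)
  qed
qed

section \<open>Face angles\<close>

text \<open>The shape of the path at column \<open>j + k\<close> decides which octahedron contains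
  each angle: at a local minimum or maximum all four lie in one octahedron, and on a monotone
  stretch the six are spread over several.\<close>

lemma face_angle_bounds:
  fixes f n
  defines "H \<equiv> max_path f (n + 1)"
  assumes f: "admissible f" and d: "0 < d" "d \<le> 1"
    and level: "H (j + k) = int m + 3"
    and bulk: "\<And>j' k' m'. \<bar>j' - j\<bar> \<le> 1 \<Longrightarrow> \<bar>k' - k\<bar> \<le> 1 \<Longrightarrow> m \<le> m' \<Longrightarrow>
      2 * ((real_of_int j')\<^sup>2 + (real_of_int k')\<^sup>2) \<le> (1 - d) * (real m')\<^sup>2"
    and cons: "consecutive f n (j + k) e e'"
  shows "face_angle f n (j, k) e e' \<in> {(d\<^sup>2 / 24) ^ 3 / 32<..<pi - (d\<^sup>2 / 24) ^ 3 / 32}"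
    (is "_ \<in> ?I")
proof -
  have ud: "up_down_path H"
    using max_path_props(1)[OF f] unfolding H_def path_below_def by blast
  have par: "odd (int m + 3 + (j + k))" using ud level unfolding up_down_path_def by metis
  have step: "H (j + k + 1) = int m + 4 \<or> H (j + k + 1) = int m + 2"
    "H (j + k - 1) = int m + 4 \<or> H (j + k - 1) = int m + 2"
  proof -
    have "H (j + k + 1) - H (j + k) = 1 \<or> H (j + k + 1) - H (j + k) = - 1"
      "H (j + k - 1 + 1) - H (j + k - 1) = 1 \<or> H (j + k - 1 + 1) - H (j + k - 1) = - 1"
      using ud unfolding up_down_path_def by blast+
    then show "H (j + k + 1) = int m + 4 \<or> H (j + k + 1) = int m + 2"
      "H (j + k - 1) = int m + 4 \<or> H (j + k - 1) = int m + 2" using level by auto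
  qed
  have corner: "Arg ((y - v) / (x - v)) \<in> ?I"
    if "(v, x, y) \<in> octahedron_corners j' k' m'" "\<bar>j' - j\<bar> \<le> 1" "\<bar>k' - k\<bar> \<le> 1" "m \<le> m'"
      "even (j' + k' + int m')" for v x y j' k' m'
    using octahedron_angles[OF d that(5) bulk[OF that(2-4)] that(1)] .
  have idx: "j + (k + 1) = j + k + 1" "j + (k - 1) = j + k - 1" "j + 1 + k = j + k + 1" "j - 1 + k = j + k - 1"
     "j + 1 + (k - 1) = j + k" "j - 1 + (k + 1) = j + k"
    by simp_all
  have v: "t_emb f n (j, k) = aztec j k (m + 3)"
    "t_emb f n (j + 1, k - 1) = aztec (j + 1) (k - 1) (m + 3)"
    "t_emb f n (j - 1, k + 1) = aztec (j - 1) (k + 1) (m + 3)"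
    unfolding t_emb_def H_def[symmetric] prod.case idx level by (simp_all add: nat_add_distrib)
  have up: "t_emb f n (j + 1, k) = aztec (j + 1) k (m + 4)" "t_emb f n (j, k + 1) = aztec j (k + 1) (m + 4)"
    if "H (j + k + 1) = int m + 4"
    unfolding t_emb_def H_def[symmetric] prod.case idx that by (simp_all add: nat_add_distrib)
  have up': "t_emb f n (j - 1, k) = aztec (j - 1) k (m + 4)" "t_emb f n (j, k - 1) = aztec j (k - 1) (m + 4)"
    if "H (j + k - 1) = int m + 4"
    unfolding t_emb_def H_def[symmetric] prod.case idx that by (simp_all add: nat_add_distrib)
  have down: "t_emb f n (j + 1, k) = aztec (j + 1) k (m + 2)" "t_emb f n (j, k + 1) = aztec j (k + 1) (m + 2)"
    if "H (j + k + 1) = int m + 2"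
    unfolding t_emb_def H_def[symmetric] prod.case idx that by (simp_all add: nat_add_distrib)
  have down': "t_emb f n (j - 1, k) = aztec (j - 1) k (m + 2)" "t_emb f n (j, k - 1) = aztec j (k - 1) (m + 2)"
    if "H (j + k - 1) = int m + 2"
    unfolding t_emb_def H_def[symmetric] prod.case idx that by (simp_all add: nat_add_distrib)
  \<comment> \<open>A face at level \<open>m + 3\<close> is the bottom of the octahedron of
    parameter \<open>m + 2\<close>, the top of that of parameter \<open>m\<close>, and an equatorial
    vertex of those of parameter \<open>m + 1\<close> around its four neighbours.\<close>
  have bottom: "Arg ((y - v) / (x - v)) \<in> ?I" if "(v, x, y) \<in> octahedron_corners j k (m + 2)" for v x y
    using par by (intro corner[OF that]) auto
  have top: "Arg ((y - v) / (x - v)) \<in> ?I" if "(v, x, y) \<in> octahedron_corners j k m" for v x y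
    using par by (intro corner[OF that]) auto
  have side: "Arg ((y - v) / (x - v)) \<in> ?I" if "(v, x, y) \<in> octahedron_corners j (k + 1) (m + 1) \<union>
      octahedron_corners j (k - 1) (m + 1) \<union> octahedron_corners (j + 1) k (m + 1) \<union>
      octahedron_corners (j - 1) k (m + 1)" for v x y
    using that by (elim UnE; intro corner; assumption?) (use par in auto)
  have adds: "(j, k) + (1, 0) = (j + 1, k)" "(j, k) + (0, 1) = (j, k + 1)" "(j, k) + (- 1, 0) = (j - 1, k)"
    "(j, k) + (0, - 1) = (j, k - 1)" "(j, k) + (- 1, 1) = (j - 1, k + 1)" "(j, k) + (1, - 1) = (j + 1, k - 1)"
    by simp_all
  note mem_simps = octahedron_corners_def Let_def add.assoc
  note hex = hexagonal_column_def[of f n "j + k", unfolded Let_def, folded H_def] level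
  note unf = face_angle_def dt_emb_def adds v
  consider (pit) "H (j + k + 1) = int m + 4" "H (j + k - 1) = int m + 4"
    | (peak) "H (j + k + 1) = int m + 2" "H (j + k - 1) = int m + 2"
    | (rise) "H (j + k + 1) = int m + 4" "H (j + k - 1) = int m + 2"
    | (fall) "H (j + k + 1) = int m + 2" "H (j + k - 1) = int m + 4"
    using step by blast
  then show ?thesis
  proof cases
    case pit
    have "\<not> hexagonal_column f n (j + k)" using pit by (simp add: hex)
    then have "(e, e') \<in> {((1, 0), (0, 1)), ((0, 1), (- 1, 0)), ((- 1, 0), (0, - 1)), ((0, - 1), (1, 0))}"
      using cons by (auto simp: consecutive_def directions_def)
    then show ?thesis
      unfolding insert_iff prod.inject
      apply (elim disjE conjE emptyE; hypsubst)
      subgoal unfolding unf up[OF pit(1)] up'[OF pit(2)] by (rule bottom) (simp add: mem_simps del: One_nat_def add_2_eq_Suc' aztec.simps)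
      subgoal unfolding unf up[OF pit(1)] up'[OF pit(2)] by (rule bottom) (simp add: mem_simps del: One_nat_def add_2_eq_Suc' aztec.simps)
      subgoal unfolding unf up[OF pit(1)] up'[OF pit(2)] by (rule bottom) (simp add: mem_simps del: One_nat_def add_2_eq_Suc' aztec.simps)
      subgoal unfolding unf up[OF pit(1)] up'[OF pit(2)] by (rule bottom) (simp add: mem_simps del: One_nat_def add_2_eq_Suc' aztec.simps)
      done
  next
    case peak
    have "\<not> hexagonal_column f n (j + k)" using peak by (simp add: hex)
    then have "(e, e') \<in> {((1, 0), (0, 1)), ((0, 1), (- 1, 0)), ((- 1, 0), (0, - 1)), ((0, - 1), (1, 0))}"
      using cons by (auto simp: consecutive_def directions_def)
    then show ?thesis
      unfolding insert_iff prod.inject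
      apply (elim disjE conjE emptyE; hypsubst)
      subgoal unfolding unf down[OF peak(1)] down'[OF peak(2)] by (rule top) (simp add: mem_simps del: One_nat_def add_2_eq_Suc' aztec.simps)
      subgoal unfolding unf down[OF peak(1)] down'[OF peak(2)] by (rule top) (simp add: mem_simps del: One_nat_def add_2_eq_Suc' aztec.simps)
      subgoal unfolding unf down[OF peak(1)] down'[OF peak(2)] by (rule top) (simp add: mem_simps del: One_nat_def add_2_eq_Suc' aztec.simps)
      subgoal unfolding unf down[OF peak(1)] down'[OF peak(2)] by (rule top) (simp add: mem_simps del: One_nat_def add_2_eq_Suc' aztec.simps)
      done
  next
    case rise
    have "hexagonal_column f n (j + k)" using rise by (simp add: hex)
    then have "(e, e') \<in> {((1, 0), (0, 1)), ((0, 1), (- 1, 1)), ((- 1, 1), (- 1, 0)), ((- 1, 0), (0, - 1)), ((0, - 1), (1, - 1)), ((1, - 1), (1, 0))}"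
      using cons by (auto simp: consecutive_def directions_def)
    then show ?thesis
      unfolding insert_iff prod.inject
      apply (elim disjE conjE emptyE; hypsubst)
      subgoal unfolding unf up[OF rise(1)] down'[OF rise(2)] by (rule bottom) (simp add: mem_simps del: One_nat_def add_2_eq_Suc' aztec.simps)
      subgoal unfolding unf up[OF rise(1)] down'[OF rise(2)] by (rule side) (simp add: mem_simps del: One_nat_def add_2_eq_Suc' aztec.simps)
      subgoal unfolding unf up[OF rise(1)] down'[OF rise(2)] by (rule side) (simp add: mem_simps del: One_nat_def add_2_eq_Suc' aztec.simps)
      subgoal unfolding unf up[OF rise(1)] down'[OF rise(2)] by (rule top) (simp add: mem_simps del: One_nat_def add_2_eq_Suc' aztec.simps)
      subgoal unfolding unf up[OF rise(1)] down'[OF rise(2)] by (rule side) (simp add: mem_simps del: One_nat_def add_2_eq_Suc' aztec.simps)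
      subgoal unfolding unf up[OF rise(1)] down'[OF rise(2)] by (rule side) (simp add: mem_simps del: One_nat_def add_2_eq_Suc' aztec.simps)
      done
  next
    case fall
    have "hexagonal_column f n (j + k)" using fall by (simp add: hex)
    then have "(e, e') \<in> {((1, 0), (0, 1)), ((0, 1), (- 1, 1)), ((- 1, 1), (- 1, 0)), ((- 1, 0), (0, - 1)), ((0, - 1), (1, - 1)), ((1, - 1), (1, 0))}"
      using cons by (auto simp: consecutive_def directions_def)
    then show ?thesis
      unfolding insert_iff prod.inject
      apply (elim disjE conjE emptyE; hypsubst)
      subgoal unfolding unf down[OF fall(1)] up'[OF fall(2)] by (rule top) (simp add: mem_simps del: One_nat_def add_2_eq_Suc' aztec.simps)
      subgoal unfolding unf down[OF fall(1)] up'[OF fall(2)] by (rule side) (simp add: mem_simps del: One_nat_def add_2_eq_Suc' aztec.simps)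
      subgoal unfolding unf down[OF fall(1)] up'[OF fall(2)] by (rule side) (simp add: mem_simps del: One_nat_def add_2_eq_Suc' aztec.simps)
      subgoal unfolding unf down[OF fall(1)] up'[OF fall(2)] by (rule bottom) (simp add: mem_simps del: One_nat_def add_2_eq_Suc' aztec.simps)
      subgoal unfolding unf down[OF fall(1)] up'[OF fall(2)] by (rule side) (simp add: mem_simps del: One_nat_def add_2_eq_Suc' aztec.simps)
      subgoal unfolding unf down[OF fall(1)] up'[OF fall(2)] by (rule side) (simp add: mem_simps del: One_nat_def add_2_eq_Suc' aztec.simps)
      done
  qed
qed

theorem lemma5p13:
  fixes f :: "real \<Rightarrow> real" and K :: "(real \<times> real) set"
  assumes "admissible f"
    and "compact K"
    and "K \<subseteq> liquid_region f"
  shows "\<exists>N>0::real. \<exists>\<epsilon>\<in>{0<..<pi}.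
           \<forall>(n::nat) (j::int) (k::int) d d'.
             real n > N \<and> consecutive f n (j + k) d d' \<and>
             rescaled_edge n (j, k) d \<subseteq> K \<and> rescaled_edge n (j, k) d' \<subseteq> K \<longrightarrow>
             face_angle f n (j, k) d d' \<in> {\<epsilon><..<pi - \<epsilon>}"
proof -
  obtain d N where d: "0 < d" "d \<le> 1" and N: "0 < N"
    and bulk: "\<And>n j k j' k' m. real n > N \<Longrightarrow> rescaled_point n (j, k) \<in> K \<Longrightarrow> \<bar>j' - j\<bar> \<le> 1 \<Longrightarrow> \<bar>k' - k\<bar> \<le> 1 \<Longrightarrow>
      max_path f (n + 1) (j + k) - 3 \<le> int m \<Longrightarrow>
      2 * ((real_of_int j')\<^sup>2 + (real_of_int k')\<^sup>2) \<le> (1 - d) * (real m)\<^sup>2"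
    and level: "\<And>n j k. real n > N \<Longrightarrow> rescaled_point n (j, k) \<in> K \<Longrightarrow> 3 \<le> max_path f (n + 1) (j + k)"
    using max_path_bulk[OF assms] by blast
  \<comment> \<open>\<open>d^2 / 24\<close> is the bound on the ratios, and the cube divided by 32
    is the loss in passing to angles.\<close>
  define \<epsilon> where "\<epsilon> = (d\<^sup>2 / 24) ^ 3 / 32"
  have "d\<^sup>2 / 24 \<le> 1" "0 < d\<^sup>2 / 24" using d power_le_one[of d 2] by auto
  then have "0 < \<epsilon>" "\<epsilon> \<le> 1 / 32" using power_le_one[of "d\<^sup>2 / 24" 3] by (auto simp: \<epsilon>_def)
  then have \<epsilon>: "\<epsilon> \<in> {0<..<pi}" using pi_gt3 by auto
  have "face_angle f n (j, k) e e' \<in> {\<epsilon><..<pi - \<epsilon>}"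
    if n: "real n > N" and cons: "consecutive f n (j + k) e e'" and e: "rescaled_edge n (j, k) e \<subseteq> K"
    for n j k e e'
  proof -
    have p: "rescaled_point n (j, k) \<in> K" using e by (auto simp: rescaled_edge_def)
    define m where "m = nat (max_path f (n + 1) (j + k) - 3)"
    have m: "max_path f (n + 1) (j + k) = int m + 3" using level[OF n p] by (simp add: m_def)
    show ?thesis unfolding \<epsilon>_def
      by (rule face_angle_bounds[OF assms(1) d m _ cons]) (rule bulk[OF n p], use m in simp_all)
  qed
  then show ?thesis using N \<epsilon> by blast
qed

end
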